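(* Let $k>2$ be an integer, let $\epsilon>0$ be sufficiently small as a function of $k$, and let $n=\Omega_k\big(\log(1/\epsilon)/\log\log(1/\epsilon)\big)^{k-1}$. Then any $\epsilon$-cover of $\mathcal{M}_{n,k}$ under the total variation distance has size at least $n^{\Omega(k)}\cdot(1/\epsilon)^{\Omega_k(\log(1/\epsilon)/\log\log(1/\epsilon))^{k-1}}$.
   Context: A $k$-CRV is a random vector supported on the standard basis vectors $\{e_1,\dots,e_k\}$ of $\mathbb{R}^k$; an $(n,k)$-PMD is the distribution of a sum of $n$ independent (not necessarily identically distributed) $k$-CRVs; $\mathcal{M}_{n,k}$ is the set of all $(n,k)$-PMDs. Total variation distance: $d_{\mathrm{TV}}(\mathbf{P},\mathbf{Q})=\frac12\sum_x|\mathbf{P}(x)-\mathbf{Q}(x)|$. An $\epsilon$-cover of $\mathcal{M}_{n,k}$ is a set $\mathcal{C}$ of distributions such that every element of $\mathcal{M}_{n,k}$ is within total variation distance $\epsilon$ of some element of $\mathcal{C}$. Notation: $\Omega(\cdot)$ hides absolute constants, $\Omega_k(\cdot)$ hides constants depending only on $k$. *)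

theory Defs
  imports "HOL-Probability.Probability"
begin

text \<open>
  The dimension \<open>k\<close> is a variable of the statement, so vectors of \<open>\<real>\<^sup>k\<close> are functions
  \<open>nat \<Rightarrow> real\<close> vanishing from index \<open>k\<close> on; this is the carrier of the library's
  \<^const>\<open>Euclidean_space\<close>. Coordinates are counted from \<open>0\<close>.
\<close>

definition std_basis :: "nat \<Rightarrow> nat \<Rightarrow> real" where
  "std_basis i = (\<lambda>j. if j = i then 1 else 0)"

definition is_CRV :: "nat \<Rightarrow> (nat \<Rightarrow> real) pmf \<Rightarrow> bool" where
  "is_CRV k p \<longleftrightarrow> set_pmf p \<subseteq> std_basis ` {..<k}"

text \<open>
  \<open>Pi_pmf {..<n} d p\<close> is the joint distribution of independent vectors with
  distributions \<open>p 0, \<dots>, p (n - 1)\<close>; the default value \<open>d\<close>, here \<open>0\<close>, is only taken at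
  indices \<open>\<ge> n\<close>, which the sum does not use.
\<close>

definition sum_indep_pmf :: "nat \<Rightarrow> (nat \<Rightarrow> (nat \<Rightarrow> real) pmf) \<Rightarrow> (nat \<Rightarrow> real) pmf" where
  "sum_indep_pmf n p = map_pmf (\<lambda>X j. \<Sum>i<n. X i j) (Pi_pmf {..<n} (\<lambda>_. 0) p)"

definition PMDs :: "nat \<Rightarrow> nat \<Rightarrow> (nat \<Rightarrow> real) pmf set" where
  "PMDs n k = {sum_indep_pmf n p | p. \<forall>i<n. is_CRV k (p i)}"

definition dTV :: "'a pmf \<Rightarrow> 'a pmf \<Rightarrow> real" where
  "dTV P Q = 1 / 2 * (\<Sum>\<^sub>\<infinity>x. \<bar>pmf P x - pmf Q x\<bar>)"

text \<open>The members of a cover need not themselves be Poisson multinomial distributions.\<close>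

definition is_PMD_cover :: "real \<Rightarrow> nat \<Rightarrow> nat \<Rightarrow> (nat \<Rightarrow> real) pmf set \<Rightarrow> bool" where
  "is_PMD_cover \<epsilon> n k C \<longleftrightarrow>
     (\<forall>Q\<in>C. set_pmf Q \<subseteq> topspace (Euclidean_space k)) \<and>
     (\<forall>P\<in>PMDs n k. \<exists>Q\<in>C. dTV P Q \<le> \<epsilon>)"

end

theory Submission
  imports Defs
begin

text \<open>
  Let \<open>d = k - 1\<close>, let \<open>m\<close> be a small multiple of \<open>log (1/\<epsilon>) / log log (1/\<epsilon>)\<close>, and give the \<open>t\<close>-th
  categorical variable, \<open>t < m\<^sup>d\<close>, odds \<open>u\<^sub>t\<close> against \<open>e\<^sub>d\<close>, where \<open>T u\<^sub>t\<close> is a point of the grid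
  \<open>{0, 2, \<dots>, 2 (m - 1)}\<^sup>d\<close> whose first coordinate is shifted by some
  \<open>\<delta>\<^sub>t \<in> \<surd>\<epsilon> \<int> \<inter> [0, 1]\<close>; \<open>T\<close> is a power of \<open>m\<close> up to a constant, so that the sum is \<open>0\<close> outside
  coordinate \<open>d\<close> with probability at least \<open>1/2\<close>. Up to a factor, the generating function of the sum in
  direction \<open>w\<close> is \<open>\<Prod>\<^sub>t (1 + z (w \<bullet> u\<^sub>t))\<close>. If two such sums are \<open>O(\<epsilon>)\<close>-close, then so are the
  coefficients, hence by Newton's identities the power sums \<open>\<Sum>\<^sub>t (w \<bullet> u\<^sub>t)\<^sup>j\<close> (up to \<open>6\<^sup>j\<close>), hence by
  polarization all sums \<open>\<Sum>\<^sub>t f(u\<^sub>t)\<close> with \<open>f\<close> a product of at most \<open>k m\<close> affine forms. Taking \<open>f\<close>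
  to vanish at all the points except one shows that the \<open>\<delta>\<^sub>t\<close> agree. The factor \<open>n\<^bsup>\<Omega>(k)\<^esup>\<close> comes from the
  point masses among the Poisson multinomial distributions: the size of a cover dominates both counts, hence
  their geometric mean.
\<close>

section \<open>Newton's identities and the stability of power sums\<close>

text \<open>The logarithmic derivative of the product is the sum of the terms
  \<open>r s / (q s + r s * X)\<close>. Each of them is a geometric series whose coefficients are
  signed powers of \<open>r s / q s\<close>.\<close>

lemma newton_fps:
  fixes q r :: "'b \<Rightarrow> 'a::field_char_0"
  assumes "finite S" and "\<And>s. s \<in> S \<Longrightarrow> q s \<noteq> 0"
  shows "fps_deriv (\<Prod>s\<in>S. fps_const (q s) + fps_const (r s) * fps_X) =
    (\<Prod>s\<in>S. fps_const (q s) + fps_const (r s) * fps_X) *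
    Abs_fps (\<lambda>i. (-1) ^ i * (\<Sum>s\<in>S. (r s / q s) ^ Suc i))"
  using assms
proof (induction S rule: finite_induct)
  case empty
  then show ?case by (simp add: fps_eq_iff)
next
  case (insert s S)
  define F where "F = (\<Prod>s\<in>S. fps_const (q s) + fps_const (r s) * fps_X)"
  define G where "G = Abs_fps (\<lambda>i. (-1) ^ i * (\<Sum>s\<in>S. (r s / q s) ^ Suc i))"
  define l where "l = fps_const (q s) + fps_const (r s) * fps_X"
  define g where "g = Abs_fps (\<lambda>i. (-1) ^ i * (r s / q s) ^ Suc i)"
  have IH: "fps_deriv F = F * G"
    using insert unfolding F_def G_def by simp
  have qs: "q s \<noteq> 0" using insert by simp
  have "fps_nth (l * g) n = fps_nth (fps_const (r s)) n" for n
  proof (cases n)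
    case 0
    then show ?thesis using qs by (simp add: l_def g_def)
  next
    case (Suc n')
    have "l * g = fps_const (q s) * g + fps_const (r s) * (fps_X * g)"
      by (simp add: l_def distrib_right mult.assoc)
    then show ?thesis using qs Suc by (simp add: g_def)
  qed
  then have lg: "l * g = fps_const (r s)" by (simp add: fps_eq_iff)
  have Gg: "Abs_fps (\<lambda>i. (-1) ^ i * (\<Sum>s\<in>insert s S. (r s / q s) ^ Suc i)) = G + g"
    using insert unfolding G_def g_def by (simp add: fps_eq_iff algebra_simps)
  have "fps_deriv (l * F) = l * (F * G) + fps_const (r s) * F"
    using IH by (simp add: l_def algebra_simps)
  also have "\<dots> = (l * F) * (G + g)"
    unfolding lg[symmetric] by (simp only: algebra_simps)
  finally show ?case
    using insert.hyps unfolding Gg F_def l_def by simp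
qed

lemma newton_identity:
  fixes q r :: "'b \<Rightarrow> 'a::field_char_0"
  assumes "finite S" and "\<And>s. s \<in> S \<Longrightarrow> q s \<noteq> 0"
  shows "of_nat (Suc n) * coeff (\<Prod>s\<in>S. [:q s, r s:]) (Suc n) =
    (\<Sum>i\<le>n. coeff (\<Prod>s\<in>S. [:q s, r s:]) (n - i) * ((-1) ^ i * (\<Sum>s\<in>S. (r s / q s) ^ Suc i)))"
proof -
  define F where "F = (\<Prod>s\<in>S. fps_const (q s) + fps_const (r s) * fps_X)"
  have F: "fps_of_poly (\<Prod>s\<in>S. [:q s, r s:]) = F"
    unfolding F_def fps_of_poly_prod
    by (intro prod.cong refl) (simp add: fps_of_poly_pCons mult.commute[of fps_X])
  have c: "coeff (\<Prod>s\<in>S. [:q s, r s:]) j = fps_nth F j" for j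
    unfolding F[symmetric] by simp
  define G where "G = Abs_fps (\<lambda>i. (-1) ^ i * (\<Sum>s\<in>S. (r s / q s) ^ Suc i))"
  have "fps_deriv F = F * G"
    unfolding F_def G_def by (rule newton_fps[OF assms])
  also have "\<dots> = G * F" by (rule mult.commute)
  finally have "fps_deriv F = G * F" .
  then have "fps_nth (fps_deriv F) n = (\<Sum>i\<le>n. fps_nth G i * fps_nth F (n - i))"
    by (simp add: fps_mult_nth atLeast0AtMost)
  moreover have "fps_nth (fps_deriv F) n = of_nat (Suc n) * fps_nth F (Suc n)"
    by simp
  ultimately show ?thesis
    unfolding c by (simp only: G_def fps_nth_Abs_fps mult.commute)
qed

text \<open>Subtracting the two identities isolates \<open>e 0 * (p (Suc n) - p' (Suc n))\<close>.
  As \<open>e 0\<close> is at least 1/2, each error is at most twice the sum of the earlier errors,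
  plus a multiple of \<tau> linear in \<open>n\<close>. The base 6 absorbs both.\<close>

lemma power_sum_stability:
  fixes e e' p p' :: "nat \<Rightarrow> real"
  assumes e: "\<And>n. of_nat (Suc n) * e (Suc n) = (\<Sum>i\<le>n. e (n - i) * ((-1) ^ i * p (Suc i)))"
    and e': "\<And>n. of_nat (Suc n) * e' (Suc n) = (\<Sum>i\<le>n. e' (n - i) * ((-1) ^ i * p' (Suc i)))"
    and diff: "\<And>n. \<bar>e n - e' n\<bar> \<le> \<tau>"
    and e0: "e 0 \<ge> 1 / 2" and e1: "\<And>n. \<bar>e n\<bar> \<le> 1"
    and p1: "\<And>n. \<bar>p' (Suc n)\<bar> \<le> 1"
  shows "\<bar>p (Suc n) - p' (Suc n)\<bar> \<le> 6 ^ Suc n * \<tau>"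
proof (induction n rule: less_induct)
  case (less n)
  have \<tau>: "0 \<le> \<tau>" using diff[of 0] by linarith
  \<comment> \<open>A bound is assumed for \<open>p'\<close> but not for \<open>p\<close>, so each
    difference of products is split around \<open>e (n - i) * (p (Suc i) - p' (Suc i))\<close>, with
    remainder at most \<tau>.\<close>
  define D where "D i = e (n - i) * p (Suc i) - e' (n - i) * p' (Suc i)" for i
  have Dle: "\<bar>D i - e (n - i) * (p (Suc i) - p' (Suc i))\<bar> \<le> \<tau>" for i
  proof -
    have "D i - e (n - i) * (p (Suc i) - p' (Suc i)) = (e (n - i) - e' (n - i)) * p' (Suc i)"
      unfolding D_def by (simp add: algebra_simps)
    also have "\<bar>\<dots>\<bar> \<le> \<tau> * 1"
      unfolding abs_mult by (intro mult_mono diff p1 \<tau>) auto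
    finally show ?thesis by simp
  qed
  have "real (Suc n) * (e (Suc n) - e' (Suc n)) = (\<Sum>i\<le>n. (-1) ^ i * D i)"
    unfolding D_def right_diff_distrib e e' sum_subtractf[symmetric]
    by (intro sum.cong) (auto simp: algebra_simps)
  also have "\<dots> = (\<Sum>i<n. (-1) ^ i * D i) + (-1) ^ n * D n"
    by (simp flip: lessThan_Suc_atMost)
  finally have "(-1) ^ n * D n = real (Suc n) * (e (Suc n) - e' (Suc n)) - (\<Sum>i<n. (-1) ^ i * D i)"
    by simp
  moreover have "\<bar>D n\<bar> = \<bar>(-1) ^ n * D n\<bar>"
    by (simp add: abs_mult power_abs)
  ultimately have "\<bar>D n\<bar> = \<bar>real (Suc n) * (e (Suc n) - e' (Suc n)) - (\<Sum>i<n. (-1) ^ i * D i)\<bar>"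
    by (simp only:)
  also have "\<dots> \<le> real (Suc n) * \<tau> + (\<Sum>i<n. \<bar>D i\<bar>)"
  proof -
    have "\<bar>real (Suc n) * (e (Suc n) - e' (Suc n))\<bar> \<le> real (Suc n) * \<tau>"
      unfolding abs_mult using diff by (intro mult_mono) auto
    moreover have "\<bar>\<Sum>i<n. (-1) ^ i * D i\<bar> \<le> (\<Sum>i<n. \<bar>D i\<bar>)"
      by (rule order_trans[OF sum_abs]) (simp add: abs_mult power_abs)
    ultimately show ?thesis by linarith
  qed
  also have "(\<Sum>i<n. \<bar>D i\<bar>) \<le> (\<Sum>i<n. 6 ^ Suc i * \<tau> + \<tau>)"
  proof (rule sum_mono)
    fix i assume "i \<in> {..<n}"
    then have "\<bar>p (Suc i) - p' (Suc i)\<bar> \<le> 6 ^ Suc i * \<tau>" using less by auto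
    then have "\<bar>e (n - i) * (p (Suc i) - p' (Suc i))\<bar> \<le> 1 * (6 ^ Suc i * \<tau>)"
      unfolding abs_mult by (intro mult_mono e1) auto
    then show "\<bar>D i\<bar> \<le> 6 ^ Suc i * \<tau> + \<tau>" using Dle[of i] by linarith
  qed
  also have "\<dots> = ((\<Sum>i<n. 6 ^ Suc i) + real n) * \<tau>"
    by (simp add: sum.distrib sum_distrib_right distrib_right)
  also have "(\<Sum>i<n. 6 ^ Suc i) = (6 ^ Suc n - 6) / (5::real)"
    by (induction n) (auto simp: field_simps)
  finally have "\<bar>D n\<bar> \<le> real (Suc n) * \<tau> + ((6 ^ Suc n - 6) / 5 + real n) * \<tau>" by simp
  then have "\<bar>e 0 * (p (Suc n) - p' (Suc n))\<bar> \<le>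
      real (Suc n) * \<tau> + ((6 ^ Suc n - 6) / 5 + real n) * \<tau> + \<tau>"
    using Dle[of n] by simp
  also have "\<dots> = (2 * (real n + 1) + (6 ^ Suc n - 6) / 5) * \<tau>"
    by (simp add: algebra_simps)
  also have "\<dots> \<le> (6 ^ Suc n / 2) * \<tau>"
  proof (rule mult_right_mono[OF _ \<tau>])
    have "10 * real n + 4 \<le> 9 * 6 ^ n" by (induction n) auto
    then show "2 * (real n + 1) + (6 ^ Suc n - 6) / 5 \<le> (6::real) ^ Suc n / 2"
      by (simp add: field_simps)
  qed
  finally have "e 0 * \<bar>p (Suc n) - p' (Suc n)\<bar> \<le> 6 ^ Suc n / 2 * \<tau>"
    using e0 by (simp add: abs_mult)
  moreover have "1 / 2 * \<bar>p (Suc n) - p' (Suc n)\<bar> \<le> e 0 * \<bar>p (Suc n) - p' (Suc n)\<bar>"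
    using e0 by (intro mult_right_mono) auto
  ultimately show ?case by simp
qed

section \<open>Polarization: from power sums to products of affine forms\<close>

text \<open>The alternating sum is an iterated finite difference of the \<open>j\<close>-th power at
  \<open>x\<close> with steps \<open>b r\<close>. Each difference lowers the degree by one, so lower
  powers vanish and the power \<open>card R\<close> leaves a constant.\<close>

lemma polarization_aux:
  fixes b :: "'b \<Rightarrow> 'a::{comm_ring_1, ring_char_0}"
  assumes "finite R" and "j \<le> card R"
  shows "(\<Sum>S\<in>Pow R. (-1) ^ card (R - S) * (x + sum b S) ^ j) =
    (if j = card R then fact (card R) * prod b R else 0)"
  using assms
proof (induction R arbitrary: x j rule: finite_induct)
  case empty
  then show ?case by simp
next
  case (insert r R)
  let ?s = "\<lambda>j x. \<Sum>S\<in>Pow R. (-1) ^ card (R - S) * (x + sum b S) ^ j"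
  have inj: "inj_on (insert r) (Pow R)"
    using insert.hyps by (auto simp: inj_on_def)
  have "(\<Sum>S\<in>Pow (insert r R). (-1) ^ card (insert r R - S) * (x + sum b S) ^ j) =
    (\<Sum>S\<in>Pow R. (-1) ^ card (insert r R - S) * (x + sum b S) ^ j) +
    (\<Sum>S\<in>Pow R. (-1) ^ card (insert r R - insert r S) * (x + sum b (insert r S)) ^ j)"
    unfolding Pow_insert using insert.hyps
    by (subst sum.union_disjoint) (auto simp: sum.reindex[OF inj])
  also have "(\<Sum>S\<in>Pow R. (-1) ^ card (insert r R - S) * (x + sum b S) ^ j) =
      (\<Sum>S\<in>Pow R. - ((-1) ^ card (R - S) * (x + sum b S) ^ j))"
  proof (intro sum.cong refl)
    fix S assume S: "S \<in> Pow R"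
    then have "insert r R - S = insert r (R - S)" "r \<notin> R - S" "finite (R - S)"
      using insert.hyps by auto
    then show "(-1) ^ card (insert r R - S) * (x + sum b S) ^ j = - ((-1) ^ card (R - S) * (x + sum b S) ^ j)"
      by simp
  qed
  also have "(\<Sum>S\<in>Pow R. (-1) ^ card (insert r R - insert r S) * (x + sum b (insert r S)) ^ j) =
      (\<Sum>S\<in>Pow R. (-1) ^ card (R - S) * ((x + sum b S) + b r) ^ j)"
  proof (intro sum.cong refl)
    fix S assume S: "S \<in> Pow R"
    then have "insert r R - insert r S = R - S" "r \<notin> S" "finite S"
      using insert.hyps by (auto intro: finite_subset)
    then show "(-1) ^ card (insert r R - insert r S) * (x + sum b (insert r S)) ^ j =
        (-1) ^ card (R - S) * ((x + sum b S) + b r) ^ j"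
      by (simp add: algebra_simps)
  qed
  also have "\<dots> = (\<Sum>S\<in>Pow R. \<Sum>i\<le>j. of_nat (j choose i) * b r ^ (j - i) * ((-1) ^ card (R - S) * (x + sum b S) ^ i))"
    unfolding binomial_ring[of "x + sum b S" "b r" j for S] sum_distrib_left
    by (intro sum.cong refl) (simp only: mult_ac)
  also have "\<dots> = (\<Sum>i\<le>j. of_nat (j choose i) * b r ^ (j - i) * ?s i x)"
    by (subst sum.swap) (simp add: sum_distrib_left)
  \<comment> \<open>The term \<open>i = j\<close> is split off because it cancels the contribution
    of the subsets without \<open>r\<close>. The remaining exponents are at most
    \<open>card R\<close>, as the induction hypothesis requires.\<close>
  also have "\<dots> = (\<Sum>i<j. of_nat (j choose i) * b r ^ (j - i) * ?s i x) + ?s j x"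
    by (simp flip: lessThan_Suc_atMost)
  also have "(\<Sum>i<j. of_nat (j choose i) * b r ^ (j - i) * ?s i x) =
      (\<Sum>i<j. if i = card R then of_nat (j choose i) * b r ^ (j - i) * (fact (card R) * prod b R) else 0)"
    using insert.prems insert.hyps by (intro sum.cong refl, subst insert.IH) auto
  also have "\<dots> = (if card R < j then of_nat (j choose card R) * b r ^ (j - card R) * (fact (card R) * prod b R) else 0)"
    by simp
  also have "\<dots> = (if j = card (insert r R) then fact (card (insert r R)) * prod b (insert r R) else 0)"
    using insert.prems insert.hyps by (auto simp: algebra_simps not_less_eq_eq)
  finally show ?case by (simp add: sum_negf)
qed

lemma polarization:
  fixes b :: "'b \<Rightarrow> 'a::{comm_ring_1, ring_char_0}"
  assumes "finite R"
  shows "(\<Sum>S\<in>Pow R. (-1) ^ card (R - S) * sum b S ^ card R) = fact (card R) * prod b R"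
  using polarization_aux[OF assms order_refl, of 0 b] by simp

text \<open>Binomial expansion in \<open>K * x t\<close> and \<open>C\<close> reduces the claim to
  power sums. The error bounds recombine to \<open>(6 * K + K) ^ N\<close>.\<close>

lemma affine_power_stability:
  fixes x x' :: "'b \<Rightarrow> real"
  assumes H: "\<And>j. \<bar>(\<Sum>t\<in>I. x t ^ j) - (\<Sum>t\<in>I. x' t ^ j)\<bar> \<le> 6 ^ j * \<tau>"
    and "\<bar>C\<bar> \<le> K"
  shows "\<bar>(\<Sum>t\<in>I. (K * x t + C) ^ N) - (\<Sum>t\<in>I. (K * x' t + C) ^ N)\<bar> \<le> (7 * K) ^ N * \<tau>"
proof -
  have \<tau>: "\<tau> \<ge> 0" using H[of 0] by simp
  have expand: "(\<Sum>t\<in>I. (K * y t + C) ^ N) =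
      (\<Sum>j\<le>N. (of_nat (N choose j) * K ^ j * C ^ (N - j)) * (\<Sum>t\<in>I. y t ^ j))" for y :: "'b \<Rightarrow> real"
    unfolding binomial_ring sum_distrib_left
    by (subst sum.swap) (intro sum.cong refl, simp add: power_mult_distrib)
  have "\<bar>(\<Sum>t\<in>I. (K * x t + C) ^ N) - (\<Sum>t\<in>I. (K * x' t + C) ^ N)\<bar> =
    \<bar>\<Sum>j\<le>N. (of_nat (N choose j) * K ^ j * C ^ (N - j)) * ((\<Sum>t\<in>I. x t ^ j) - (\<Sum>t\<in>I. x' t ^ j))\<bar>"
    unfolding expand by (simp add: right_diff_distrib sum_subtractf)
  also have "\<dots> \<le> (\<Sum>j\<le>N. (of_nat (N choose j) * K ^ j * K ^ (N - j)) * (6 ^ j * \<tau>))"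
  proof (rule order_trans[OF sum_abs], rule sum_mono)
    fix j assume "j \<in> {..N}"
    have "\<bar>C ^ (N - j)\<bar> \<le> K ^ (N - j)"
      unfolding power_abs using assms by (intro power_mono) auto
    then show "\<bar>(of_nat (N choose j) * K ^ j * C ^ (N - j)) * ((\<Sum>t\<in>I. x t ^ j) - (\<Sum>t\<in>I. x' t ^ j))\<bar>
        \<le> (of_nat (N choose j) * K ^ j * K ^ (N - j)) * (6 ^ j * \<tau>)"
      unfolding abs_mult using H[of j] assms(2) by (intro mult_mono) (auto intro!: mult_nonneg_nonneg)
  qed
  also have "\<dots> = (\<Sum>j\<le>N. of_nat (N choose j) * (6 * K) ^ j * K ^ (N - j)) * \<tau>"
    unfolding sum_distrib_right by (intro sum.cong refl) (simp add: power_mult_distrib mult_ac)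
  also have "\<dots> = (7 * K) ^ N * \<tau>"
    unfolding binomial_ring[symmetric] by simp
  finally show ?thesis .
qed

text \<open>Polarization turns the product into a signed sum of \<open>N\<close>-th powers of
  partial sums of the forms, \<open>N\<close> being the number of forms. Each of the
  \<open>2 ^ N\<close> powers has error at most \<open>(7 * N) ^ N * \<tau>\<close>.\<close>

lemma affine_product_stability:
  fixes u u' :: "'b \<Rightarrow> nat \<Rightarrow> real" and a :: "'r \<Rightarrow> nat" and c :: "'r \<Rightarrow> real"
  assumes H: "\<And>w j. (\<And>i. i < d \<Longrightarrow> 0 \<le> w i \<and> w i \<le> 1) \<Longrightarrow>
      \<bar>(\<Sum>t\<in>I. (\<Sum>i<d. w i * u t i) ^ j) - (\<Sum>t\<in>I. (\<Sum>i<d. w i * u' t i) ^ j)\<bar> \<le> 6 ^ j * \<tau>"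
    and R: "finite R" and a: "\<And>r. r \<in> R \<Longrightarrow> a r < d" and c: "\<And>r. r \<in> R \<Longrightarrow> \<bar>c r\<bar> \<le> 1"
  shows "\<bar>(\<Sum>t\<in>I. \<Prod>r\<in>R. u t (a r) - c r) - (\<Sum>t\<in>I. \<Prod>r\<in>R. u' t (a r) - c r)\<bar>
    \<le> (14 * real (card R)) ^ card R * \<tau>"
proof (cases "R = {}")
  case True
  then show ?thesis using H[of "\<lambda>_. 0" 0] by simp
next
  case False
  define N where "N = card R"
  have N: "N > 0" using False R by (simp add: N_def card_gt_0_iff)
  have \<tau>: "\<tau> \<ge> 0" using H[of "\<lambda>_. 0" 0] by simp
  define P where "P y S = (\<Sum>t\<in>I. (\<Sum>r\<in>S. y t (a r) - c r) ^ N)" for y :: "'b \<Rightarrow> nat \<Rightarrow> real" and S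
  have pol: "fact N * (\<Sum>t\<in>I. \<Prod>r\<in>R. y t (a r) - c r) = (\<Sum>S\<in>Pow R. (-1) ^ card (R - S) * P y S)" for y
    unfolding P_def N_def sum_distrib_left
    by (subst sum.swap) (simp add: polarization[OF R] flip: sum_distrib_left)
  have bound: "\<bar>P u S - P u' S\<bar> \<le> (7 * real N) ^ N * \<tau>" if S: "S \<subseteq> R" for S
  proof -
    have fS: "finite S" using S R finite_subset by blast
    \<comment> \<open>The weight of coordinate \<open>i\<close> is the number of forms in
      \<open>S\<close> reading it. Dividing by \<open>N\<close> brings it into [0,1], where the
      hypothesis applies; the factor \<open>N\<close> reappears as the \<open>K\<close> of the
      affine power bound.\<close>
    define w where "w i = real (card {r \<in> S. a r = i}) / real N" for i
    define C where "C = - sum c S"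
    have w01: "0 \<le> w i \<and> w i \<le> 1" for i
      using N R S unfolding w_def N_def
      by (auto simp: divide_le_eq intro!: card_mono)
    have C: "\<bar>C\<bar> \<le> real N"
    proof -
      have "\<bar>C\<bar> \<le> (\<Sum>r\<in>S. \<bar>c r\<bar>)" unfolding C_def by (simp add: sum_abs)
      also have "\<dots> \<le> (\<Sum>r\<in>S. 1)" using S c by (intro sum_mono) auto
      also have "\<dots> \<le> real N" using card_mono[OF R S] by (simp add: N_def)
      finally show ?thesis .
    qed
    have form: "(\<Sum>r\<in>S. y (a r) - c r) = real N * (\<Sum>i<d. w i * y i) + C" for y :: "nat \<Rightarrow> real"
    proof -
      have "(\<Sum>r\<in>S. y (a r)) = (\<Sum>i<d. \<Sum>r\<in>{r\<in>S. a r = i}. y (a r))"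
        using fS S a by (subst sum.group) auto
      also have "\<dots> = (\<Sum>i<d. real (card {r\<in>S. a r = i}) * y i)"
        by (intro sum.cong refl) simp
      also have "\<dots> = real N * (\<Sum>i<d. w i * y i)"
        using N unfolding sum_distrib_left w_def by (intro sum.cong refl) simp
      finally show ?thesis by (simp add: C_def sum_subtractf)
    qed
    show ?thesis unfolding P_def form
      by (rule affine_power_stability[OF H C]) (rule w01)
  qed
  have "fact N * \<bar>(\<Sum>t\<in>I. \<Prod>r\<in>R. u t (a r) - c r) - (\<Sum>t\<in>I. \<Prod>r\<in>R. u' t (a r) - c r)\<bar>
      = \<bar>fact N * (\<Sum>t\<in>I. \<Prod>r\<in>R. u t (a r) - c r) - fact N * (\<Sum>t\<in>I. \<Prod>r\<in>R. u' t (a r) - c r)\<bar>"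
    by (simp add: abs_mult flip: right_diff_distrib)
  also have "\<dots> = \<bar>\<Sum>S\<in>Pow R. (-1) ^ card (R - S) * (P u S - P u' S)\<bar>"
    unfolding pol by (simp add: right_diff_distrib sum_subtractf)
  also have "\<dots> \<le> (\<Sum>S\<in>Pow R. (7 * real N) ^ N * \<tau>)"
  proof (rule order_trans[OF sum_abs], rule sum_mono)
    fix S assume "S \<in> Pow R"
    then have "\<bar>P u S - P u' S\<bar> \<le> (7 * real N) ^ N * \<tau>" by (intro bound) simp
    then show "\<bar>(-1) ^ card (R - S) * (P u S - P u' S)\<bar> \<le> (7 * real N) ^ N * \<tau>"
      unfolding abs_mult power_abs abs_minus_cancel abs_one power_one mult_1 .
  qed
  also have "\<dots> = (14 * real N) ^ N * \<tau>"
  proof -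
    have "(14 * real N) ^ N = 2 ^ N * (7 * real N) ^ N"
      unfolding power_mult_distrib[symmetric] by simp
    moreover have "real (card (Pow R)) = 2 ^ N" using R by (simp add: card_Pow N_def)
    ultimately show ?thesis by (simp only: sum_constant mult.assoc)
  qed
  finally have *: "fact N * \<bar>(\<Sum>t\<in>I. \<Prod>r\<in>R. u t (a r) - c r) - (\<Sum>t\<in>I. \<Prod>r\<in>R. u' t (a r) - c r)\<bar>
      \<le> (14 * real N) ^ N * \<tau>" .
  have "1 * \<bar>(\<Sum>t\<in>I. \<Prod>r\<in>R. u t (a r) - c r) - (\<Sum>t\<in>I. \<Prod>r\<in>R. u' t (a r) - c r)\<bar>
     \<le> fact N * \<bar>(\<Sum>t\<in>I. \<Prod>r\<in>R. u t (a r) - c r) - (\<Sum>t\<in>I. \<Prod>r\<in>R. u' t (a r) - c r)\<bar>"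
    by (intro mult_right_mono) auto
  with * show ?thesis by (simp add: N_def)
qed

section \<open>Total variation distance and test functions\<close>

lemma finite_set_PMD:
  assumes "P \<in> PMDs n k"
  shows "finite (set_pmf P)"
proof -
  obtain p where P: "P = sum_indep_pmf n p" and p: "\<And>i. i < n \<Longrightarrow> is_CRV k (p i)"
    using assms by (auto simp: PMDs_def)
  have "finite (set_pmf (p i))" if "i < n" for i
    using p[OF that] unfolding is_CRV_def by (rule finite_subset) simp
  then show ?thesis
    unfolding P sum_indep_pmf_def by (auto simp: set_Pi_pmf intro!: finite_PiE_dflt)
qed

text \<open>By the factor 1/2 in \<open>dTV\<close>, each of \<open>P\<close> and \<open>P'\<close>
  is within \<open>2 * \<epsilon>\<close> of \<open>Q\<close> in the l1 norm; the triangle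
  inequality gives \<open>4 * \<epsilon>\<close>. \<open>Q\<close> may have infinite support, but
  the sums run over the supports of \<open>P\<close> and \<open>P'\<close>.\<close>

lemma expectation_diff_le_dTV:
  fixes f :: "'a \<Rightarrow> real"
  assumes P: "finite (set_pmf P)" and P': "finite (set_pmf P')"
    and dP: "dTV P Q \<le> \<epsilon>" and dP': "dTV P' Q \<le> \<epsilon>"
    and f: "\<And>x. x \<in> set_pmf P \<union> set_pmf P' \<Longrightarrow> \<bar>f x\<bar> \<le> 1"
  shows "\<bar>measure_pmf.expectation P f - measure_pmf.expectation P' f\<bar> \<le> 4 * \<epsilon>"
proof -
  define U where "U = set_pmf P \<union> set_pmf P'"
  have U: "finite U" using P P' by (simp add: U_def)
  \<comment> \<open>The infinite sum in \<open>dTV\<close> would default to 0 without summability,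
    and would then bound no finite partial sum.\<close>
  have pmf_sum: "pmf p summable_on UNIV" for p :: "'a pmf"
  proof (rule nonneg_bounded_partial_sums_imp_summable_on[where C = 1])
    show "eventually (\<lambda>F. sum (pmf p) F \<le> 1) (finite_subsets_at_top UNIV)"
      by (rule eventually_finite_subsets_at_top_weakI)
        (simp add: measure_measure_pmf_finite[symmetric])
  qed auto
  have diff_sum: "(\<lambda>x. \<bar>pmf p x - pmf Q x\<bar>) summable_on UNIV" for p :: "'a pmf"
    by (rule summable_on_comparison_test[OF summable_on_add[OF pmf_sum[of p] pmf_sum[of Q]]])
      (auto simp: abs_le_iff add_increasing add_increasing2)
  have le: "(\<Sum>x\<in>U. \<bar>pmf p x - pmf Q x\<bar>) \<le> 2 * \<epsilon>" if "dTV p Q \<le> \<epsilon>" for p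
  proof -
    have "(\<Sum>x\<in>U. \<bar>pmf p x - pmf Q x\<bar>) \<le> (\<Sum>\<^sub>\<infinity>x. \<bar>pmf p x - pmf Q x\<bar>)"
      using U by (intro finite_sum_le_infsum diff_sum) auto
    with that show ?thesis by (simp add: dTV_def)
  qed
  have "measure_pmf.expectation p f = (\<Sum>x\<in>U. pmf p x * f x)" if "set_pmf p \<subseteq> U" for p
    using that by (subst integral_measure_pmf[OF U]) auto
  then have "measure_pmf.expectation P f - measure_pmf.expectation P' f =
      (\<Sum>x\<in>U. (pmf P x - pmf P' x) * f x)"
    by (simp add: U_def sum_subtractf left_diff_distrib)
  also have "\<bar>\<dots>\<bar> \<le> (\<Sum>x\<in>U. \<bar>pmf P x - pmf Q x\<bar> + \<bar>pmf P' x - pmf Q x\<bar>)"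
  proof (rule order_trans[OF sum_abs], rule sum_mono)
    fix x assume "x \<in> U"
    then have "\<bar>(pmf P x - pmf P' x) * f x\<bar> \<le> \<bar>pmf P x - pmf P' x\<bar> * 1"
      unfolding abs_mult using f by (intro mult_left_mono) (auto simp: U_def)
    also have "\<dots> \<le> \<bar>pmf P x - pmf Q x\<bar> + \<bar>pmf P' x - pmf Q x\<bar>" by simp
    finally show "\<bar>(pmf P x - pmf P' x) * f x\<bar> \<le> \<bar>pmf P x - pmf Q x\<bar> + \<bar>pmf P' x - pmf Q x\<bar>" .
  qed
  also have "\<dots> \<le> 4 * \<epsilon>"
    using le[OF dP] le[OF dP'] by (simp add: sum.distrib)
  finally show ?thesis .
qed

section \<open>Generating functions of sums of categorical variables\<close>

text \<open>The categorical variable whose odds of \<open>e\<^sub>i\<close> against \<open>e\<^sub>d\<close> are \<open>u i\<close>, for \<open>i < d\<close>.\<close>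

definition odds_CRV :: "nat \<Rightarrow> (nat \<Rightarrow> real) \<Rightarrow> (nat \<Rightarrow> real) pmf" where
  "odds_CRV d u = map_pmf std_basis
     (embed_pmf (\<lambda>i. (if i < d then u i else if i = d then 1 else 0) / (1 + (\<Sum>i<d. u i))))"

lemma
  assumes u: "\<And>i. i < d \<Longrightarrow> 0 \<le> u i"
  shows is_CRV_odds_CRV: "is_CRV (Suc d) (odds_CRV d u)"
    and expectation_odds_CRV: "measure_pmf.expectation (odds_CRV d u) f =
      (f (std_basis d) + (\<Sum>i<d. u i * f (std_basis i))) / (1 + (\<Sum>i<d. u i))"
proof -
  define g where "g i = (if i < d then u i else if i = d then 1 else 0) / (1 + (\<Sum>i<d. u i))" for i
  have s: "1 + (\<Sum>i<d. u i) > 0" using u by (intro add_pos_nonneg sum_nonneg) auto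
  have g0: "g i \<ge> 0" for i using u s by (auto simp: g_def)
  have sumg: "(\<Sum>i\<le>d. g i * h i) = (h d + (\<Sum>i<d. u i * h i)) / (1 + (\<Sum>i<d. u i))" for h
    by (simp add: g_def sum_divide_distrib add_divide_distrib flip: lessThan_Suc_atMost)
  have "(\<integral>\<^sup>+i. ennreal (g i) \<partial>count_space UNIV) = (\<Sum>i\<le>d. ennreal (g i))"
    by (rule nn_integral_count_space') (auto simp: g_def)
  also have "\<dots> = 1"
    using sumg[of "\<lambda>_. 1"] s g0 by (simp add: sum_ennreal)
  finally have g1: "(\<integral>\<^sup>+i. ennreal (g i) \<partial>count_space UNIV) = 1" .
  have set: "set_pmf (embed_pmf g) \<subseteq> {..d}"
    unfolding set_embed_pmf[OF g0 g1] by (auto simp: g_def split: if_splits)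
  have eq: "odds_CRV d u = map_pmf std_basis (embed_pmf g)"
    by (simp add: odds_CRV_def g_def[abs_def])
  show "is_CRV (Suc d) (odds_CRV d u)"
    using set unfolding is_CRV_def eq by (auto simp: less_Suc_eq_le)
  show "measure_pmf.expectation (odds_CRV d u) f =
      (f (std_basis d) + (\<Sum>i<d. u i * f (std_basis i))) / (1 + (\<Sum>i<d. u i))"
    unfolding eq integral_map_pmf
    using set by (subst integral_measure_pmf[of "{..d}"])
      (auto simp: pmf_embed_pmf[OF g0 g1] sumg)
qed

text \<open>The monomial with variables \<open>x\<close> and exponents \<open>y\<close>. The vectors
  of interest have natural coordinates, which \<open>nat\<close> and the floor turn into exponents.
  Its expectation is the generating function in the coordinates below \<open>d\<close>.\<close>

definition monom_at :: "nat \<Rightarrow> (nat \<Rightarrow> real) \<Rightarrow> (nat \<Rightarrow> real) \<Rightarrow> real" where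
  "monom_at d x y = (\<Prod>i<d. x i ^ nat \<lfloor>y i\<rfloor>)"

lemma monom_at_std_basis: "monom_at d x (std_basis i) = (if i < d then x i else 1)"
  by (simp add: monom_at_def std_basis_def if_distrib[of "\<lambda>z. _ ^ nat \<lfloor>z\<rfloor>"] prod.delta cong: if_cong)

lemma nat_floor_sum_std_basis:
  assumes "finite T" and "\<And>t. t \<in> T \<Longrightarrow> X t \<in> range std_basis"
  shows "nat \<lfloor>\<Sum>t\<in>T. X t i\<rfloor> = (\<Sum>t\<in>T. nat \<lfloor>X t i\<rfloor>)"
proof -
  have "X t i = real (nat \<lfloor>X t i\<rfloor>)" if "t \<in> T" for t
    using assms(2)[OF that] by (auto simp: std_basis_def)
  then have "(\<Sum>t\<in>T. X t i) = real (\<Sum>t\<in>T. nat \<lfloor>X t i\<rfloor>)" by simp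
  then show ?thesis by (simp only: floor_of_nat nat_int)
qed

lemma monom_at_sum:
  assumes "finite T" and "\<And>t. t \<in> T \<Longrightarrow> X t \<in> range std_basis"
  shows "monom_at d x (\<lambda>i. \<Sum>t\<in>T. X t i) = (\<Prod>t\<in>T. monom_at d x (X t))"
proof -
  have "monom_at d x (\<lambda>i. \<Sum>t\<in>T. X t i) = (\<Prod>i<d. \<Prod>t\<in>T. x i ^ nat \<lfloor>X t i\<rfloor>)"
    using assms by (simp add: monom_at_def nat_floor_sum_std_basis power_sum)
  also have "\<dots> = (\<Prod>t\<in>T. monom_at d x (X t))"
    unfolding monom_at_def by (rule prod.swap)
  finally show ?thesis .
qed

text \<open>Independence factors the generating function, and each factor is affine in
  \<open>x\<close> because a basis vector has a single nonzero coordinate.\<close>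

lemma expectation_monom_at:
  assumes u: "\<And>t i. t < n \<Longrightarrow> i < d \<Longrightarrow> 0 \<le> u t i" and x: "\<And>i. i < d \<Longrightarrow> 0 \<le> x i"
  shows "measure_pmf.expectation (sum_indep_pmf n (\<lambda>t. odds_CRV d (u t))) (monom_at d x) =
    (\<Prod>t<n. (1 + (\<Sum>i<d. u t i * x i)) / (1 + (\<Sum>i<d. u t i)))"
proof -
  have CRV: "set_pmf (odds_CRV d (u t)) \<subseteq> std_basis ` {..<Suc d}" if "t < n" for t
    using is_CRV_odds_CRV[of d "u t"] u that by (simp add: is_CRV_def)
  have "measure_pmf.expectation (sum_indep_pmf n (\<lambda>t. odds_CRV d (u t))) (monom_at d x) =
      measure_pmf.expectation (Pi_pmf {..<n} (\<lambda>_. 0) (\<lambda>t. odds_CRV d (u t)))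
        (\<lambda>X. monom_at d x (\<lambda>i. \<Sum>t<n. X t i))"
    by (simp add: sum_indep_pmf_def)
  also have "\<dots> = measure_pmf.expectation (Pi_pmf {..<n} (\<lambda>_. 0) (\<lambda>t. odds_CRV d (u t)))
        (\<lambda>X. \<Prod>t<n. monom_at d x (X t))"
  proof (intro integral_cong_AE, simp, simp, intro AE_pmfI monom_at_sum)
    fix X t assume "X \<in> set_pmf (Pi_pmf {..<n} (\<lambda>_. 0) (\<lambda>t. odds_CRV d (u t)))" "t \<in> {..<n}"
    then show "X t \<in> range std_basis"
      using CRV by (fastforce simp: set_Pi_pmf PiE_dflt_def)
  qed simp
  also have "\<dots> = (\<Prod>t<n. measure_pmf.expectation (odds_CRV d (u t)) (monom_at d x))"
  proof (rule expectation_prod_Pi_pmf)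
    show "integrable (measure_pmf (odds_CRV d (u t))) (monom_at d x)" if "t \<in> {..<n}" for t
      using that by (intro integrable_measure_pmf_finite finite_subset[OF CRV]) auto
    show "monom_at d x y \<ge> 0" for y
      using x unfolding monom_at_def by (intro prod_nonneg) auto
  qed simp
  also have "\<dots> = (\<Prod>t<n. (1 + (\<Sum>i<d. u t i * x i)) / (1 + (\<Sum>i<d. u t i)))"
    using u by (intro prod.cong refl) (simp add: expectation_odds_CRV monom_at_std_basis)
  finally show ?thesis .
qed

text \<open>Only \<open>z \<ge> 0\<close> is available because the product rule for \<^const>\<open>Pi_pmf\<close> behind
  \<open>expectation_monom_at\<close> needs nonnegative factors.\<close>

lemma poly_eqI_nonneg:
  fixes p q :: "real poly"
  assumes "\<And>z. z \<ge> 0 \<Longrightarrow> poly p z = poly q z"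
  shows "p = q"
proof (rule ccontr)
  assume "p \<noteq> q"
  then have "finite {z. poly (p - q) z = 0}" by (intro poly_roots_finite) simp
  moreover have "{0..} \<subseteq> {z. poly (p - q) z = 0}" using assms by auto
  ultimately have "finite {0::real..}" by (rule rev_finite_subset)
  then show False using infinite_Ici by blast
qed

text \<open>The homogeneous part of degree \<open>j\<close>: its expectation is the coefficient of
  \<open>z ^ j\<close> in the generating function along the ray \<open>z * w\<close>. For
  \<open>w\<close> in the unit cube it takes values in [0,1] and so can serve as a test
  function.\<close>

definition monom_deg_at :: "nat \<Rightarrow> (nat \<Rightarrow> real) \<Rightarrow> nat \<Rightarrow> (nat \<Rightarrow> real) \<Rightarrow> real" where
  "monom_deg_at d w j y = (if (\<Sum>i<d. nat \<lfloor>y i\<rfloor>) = j then monom_at d w y else 0)"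

lemma odds_PMD_in_PMDs:
  assumes "\<And>t i. t < n \<Longrightarrow> i < d \<Longrightarrow> 0 \<le> u t i"
  shows "sum_indep_pmf n (\<lambda>t. odds_CRV d (u t)) \<in> PMDs n (Suc d)"
  using is_CRV_odds_CRV assms unfolding PMDs_def by blast

lemma expectation_monom_deg_at:
  assumes u: "\<And>t i. t < n \<Longrightarrow> i < d \<Longrightarrow> 0 \<le> u t i" and w: "\<And>i. i < d \<Longrightarrow> 0 \<le> w i"
  shows "measure_pmf.expectation (sum_indep_pmf n (\<lambda>t. odds_CRV d (u t))) (monom_deg_at d w j) =
    coeff (\<Prod>t<n. [:1 / (1 + (\<Sum>i<d. u t i)), (\<Sum>i<d. w i * u t i) / (1 + (\<Sum>i<d. u t i)):]) j"
proof -
  define P where "P = sum_indep_pmf n (\<lambda>t. odds_CRV d (u t))"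
  define deg where "deg y = (\<Sum>i<d. nat \<lfloor>y i\<rfloor>)" for y :: "nat \<Rightarrow> real"
  \<comment> \<open>\<open>E\<close> is the generating function along the ray \<open>z * w\<close>
    as a polynomial in \<open>z\<close>; \<open>deg y\<close> collects the outcomes by
    degree.\<close>
  define E where "E = (\<Sum>y\<in>set_pmf P. monom (pmf P y * monom_at d w y) (deg y))"
  have fin: "finite (set_pmf P)"
    unfolding P_def by (rule finite_set_PMD[OF odds_PMD_in_PMDs]) (rule u)
  have "E = (\<Prod>t<n. [:1 / (1 + (\<Sum>i<d. u t i)), (\<Sum>i<d. w i * u t i) / (1 + (\<Sum>i<d. u t i)):])"
  proof (rule poly_eqI_nonneg)
    fix z :: real assume z: "z \<ge> 0"
    have "monom_at d w y * z ^ deg y = monom_at d (\<lambda>i. w i * z) y" for y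
      by (simp add: monom_at_def deg_def power_sum power_mult_distrib prod.distrib)
    then have "poly E z = measure_pmf.expectation P (monom_at d (\<lambda>i. w i * z))"
      by (subst integral_measure_pmf[OF fin]) (auto simp: E_def poly_sum poly_monom mult.assoc)
    also have "\<dots> = (\<Prod>t<n. (1 + (\<Sum>i<d. u t i * (w i * z))) / (1 + (\<Sum>i<d. u t i)))"
      unfolding P_def using u w z by (intro expectation_monom_at) auto
    also have "\<dots> = poly (\<Prod>t<n. [:1 / (1 + (\<Sum>i<d. u t i)), (\<Sum>i<d. w i * u t i) / (1 + (\<Sum>i<d. u t i)):]) z"
      unfolding poly_prod
      by (intro prod.cong refl) (simp add: sum_distrib_left add_divide_distrib sum_divide_distrib mult_ac)
    finally show "poly E z = \<dots>" .
  qed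
  moreover have "coeff E j = measure_pmf.expectation P (monom_deg_at d w j)"
    by (subst integral_measure_pmf[OF fin])
      (auto simp: E_def coeff_sum monom_deg_at_def deg_def intro!: sum.cong)
  ultimately show ?thesis by (simp add: P_def)
qed

lemma monom_deg_at_bounds:
  assumes "\<And>i. i < d \<Longrightarrow> 0 \<le> w i \<and> w i \<le> 1"
  shows "0 \<le> monom_deg_at d w j y" and "monom_deg_at d w j y \<le> 1"
  using assms unfolding monom_deg_at_def monom_at_def
  by (auto intro!: prod_nonneg prod_le_1 power_le_one)

text \<open>With \<open>s t\<close> the total odds of variable \<open>t\<close>, the product is the
  probability that all variables equal \<open>e_d\<close>. The bound keeps it at least 1/2 when the
  odds sum to at most 1/2.\<close>

lemma one_minus_sum_le_prod_inverse:
  fixes s :: "'b \<Rightarrow> real"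
  assumes "finite A" and "\<And>t. t \<in> A \<Longrightarrow> s t \<ge> 0"
  shows "1 - (\<Sum>t\<in>A. s t) \<le> (\<Prod>t\<in>A. 1 / (1 + s t))"
  using assms
proof (induction A rule: finite_induct)
  case (insert t A)
  have s: "s t \<ge> 0" "(\<Sum>t\<in>A. s t) \<ge> 0" using insert.prems by (auto intro: sum_nonneg)
  have "(1 - (\<Sum>t\<in>A. s t) - s t) * (1 + s t) = 1 - (\<Sum>t\<in>A. s t) - s t * ((\<Sum>t\<in>A. s t) + s t)"
    by (simp add: algebra_simps)
  also have "\<dots> \<le> 1 - (\<Sum>t\<in>A. s t)" using s by (simp add: mult_nonneg_nonneg)
  also have "\<dots> \<le> (\<Prod>t\<in>A. 1 / (1 + s t))" using insert by simp
  finally have "1 - (\<Sum>t\<in>A. s t) - s t \<le> (\<Prod>t\<in>A. 1 / (1 + s t)) / (1 + s t)"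
    using s by (simp add: pos_le_divide_eq)
  then show ?case using insert.hyps by (simp add: algebra_simps)
qed simp

text \<open>The coefficients of both generating functions are expectations of test functions with
  values in [0,1], hence differ by at most \<open>4 * \<epsilon>\<close>. Newton's identities
  transfer this to power sums.\<close>

lemma power_sums_close:
  assumes u: "\<And>t i. t < n \<Longrightarrow> i < d \<Longrightarrow> 0 \<le> u t i" "(\<Sum>t<n. \<Sum>i<d. u t i) \<le> 1 / 2"
    and u': "\<And>t i. t < n \<Longrightarrow> i < d \<Longrightarrow> 0 \<le> u' t i" "(\<Sum>t<n. \<Sum>i<d. u' t i) \<le> 1 / 2"
    and dTV: "dTV (sum_indep_pmf n (\<lambda>t. odds_CRV d (u t))) Q \<le> \<epsilon>"
      "dTV (sum_indep_pmf n (\<lambda>t. odds_CRV d (u' t))) Q \<le> \<epsilon>"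
    and w: "\<And>i. i < d \<Longrightarrow> 0 \<le> w i \<and> w i \<le> 1"
  shows "\<bar>(\<Sum>t<n. (\<Sum>i<d. w i * u t i) ^ j) - (\<Sum>t<n. (\<Sum>i<d. w i * u' t i) ^ j)\<bar> \<le> 6 ^ j * (4 * \<epsilon>)"
proof -
  define P where "P v = sum_indep_pmf n (\<lambda>t. odds_CRV d (v t))" for v
  define e where "e v j = measure_pmf.expectation (P v) (monom_deg_at d w j)" for v j
  define p where "p v j = (\<Sum>t<n. (\<Sum>i<d. w i * v t i) ^ j)" for v :: "nat \<Rightarrow> nat \<Rightarrow> real" and j
  define ok where "ok v \<longleftrightarrow> (\<forall>t<n. \<forall>i<d. 0 \<le> v t i) \<and> (\<Sum>t<n. \<Sum>i<d. v t i) \<le> 1 / 2"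
    for v :: "nat \<Rightarrow> nat \<Rightarrow> real"
  have ok: "ok u" "ok u'" using u u' by (auto simp: ok_def)
  have fin: "finite (set_pmf (P v))" if "ok v" for v
    unfolding P_def using that by (intro finite_set_PMD[OF odds_PMD_in_PMDs]) (auto simp: ok_def)
  have coeff: "e v j = coeff (\<Prod>t<n. [:1 / (1 + (\<Sum>i<d. v t i)), (\<Sum>i<d. w i * v t i) / (1 + (\<Sum>i<d. v t i)):]) j"
    if "ok v" for v j
    unfolding e_def P_def using that w by (intro expectation_monom_deg_at) (auto simp: ok_def)
  have pos: "1 + (\<Sum>i<d. v t i) > 0" if "ok v" "t < n" for v t
    using that by (intro add_pos_nonneg sum_nonneg) (auto simp: ok_def)
  have newton: "of_nat (Suc m) * e v (Suc m) = (\<Sum>i\<le>m. e v (m - i) * ((-1) ^ i * p v (Suc i)))"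
    if v: "ok v" for v m
  proof -
    \<comment> \<open>The normalizing constants of the two coefficients of each factor cancel in
      their ratio, leaving \<open>w\<close> applied to the odds.\<close>
    have p_eq: "p v i = (\<Sum>t<n. ((\<Sum>i<d. w i * v t i) / (1 + (\<Sum>i<d. v t i)) / (1 / (1 + (\<Sum>i<d. v t i)))) ^ i)" for i
      unfolding p_def
    proof (intro sum.cong refl)
      fix t assume "t \<in> {..<n}"
      then have "1 + (\<Sum>i<d. v t i) \<noteq> 0" using pos[OF v, of t] by simp
      then show "(\<Sum>i<d. w i * v t i) ^ i =
          ((\<Sum>i<d. w i * v t i) / (1 + (\<Sum>i<d. v t i)) / (1 / (1 + (\<Sum>i<d. v t i)))) ^ i"
        by simp
    qed
    have nonzero: "1 / (1 + (\<Sum>i<d. v t i)) \<noteq> 0" if "t \<in> {..<n}" for t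
      using pos[OF v, of t] that by simp
    show ?thesis
      unfolding coeff[OF v] p_eq by (intro newton_identity finite_lessThan nonzero)
  qed
  have eps: "\<epsilon> \<ge> 0"
    using dTV(1) by (rule order_trans[rotated]) (auto simp: dTV_def intro!: infsum_nonneg)
  have "\<bar>p u (Suc m) - p u' (Suc m)\<bar> \<le> 6 ^ Suc m * (4 * \<epsilon>)" for m
  proof (rule power_sum_stability[OF newton[OF ok(1)] newton[OF ok(2)]])
    fix m
    have "\<bar>monom_deg_at d w m y\<bar> \<le> 1" for y using monom_deg_at_bounds[OF w] by simp
    then show "\<bar>e u m - e u' m\<bar> \<le> 4 * \<epsilon>"
      unfolding e_def using dTV ok
      by (intro expectation_diff_le_dTV[where Q = Q] fin) (auto simp: P_def)
    have "e u m \<ge> 0" unfolding e_def using monom_deg_at_bounds(1)[OF w] by (intro Bochner_Integration.integral_nonneg) auto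
    moreover have "e u m \<le> 1" unfolding e_def using monom_deg_at_bounds(2)[OF w]
      by (intro measure_pmf.integral_le_const integrable_measure_pmf_finite fin ok) auto
    ultimately show "\<bar>e u m\<bar> \<le> 1" by simp
  next
    have "1 / 2 \<le> 1 - (\<Sum>t<n. \<Sum>i<d. u t i)" using u by simp
    also have "\<dots> \<le> (\<Prod>t<n. 1 / (1 + (\<Sum>i<d. u t i)))"
      using u by (intro one_minus_sum_le_prod_inverse sum_nonneg) auto
    also have "\<dots> = e u 0"
      unfolding coeff[OF ok(1)] by (simp add: poly_prod flip: poly_0_coeff_0)
    finally show "1 / 2 \<le> e u 0" .
  next
    fix m
    have s: "0 \<le> (\<Sum>i<d. w i * u' t i)" "(\<Sum>i<d. w i * u' t i) \<le> (\<Sum>i<d. u' t i)" if "t < n" for t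
      using w u'(1) that by (auto intro!: sum_nonneg sum_mono mult_left_le_one_le)
    have s1: "(\<Sum>i<d. w i * u' t i) \<le> 1" if "t < n" for t
    proof -
      have "(\<Sum>i<d. w i * u' t i) \<le> (\<Sum>i<d. u' t i)" using s that by blast
      also have "\<dots> \<le> (\<Sum>t<n. \<Sum>i<d. u' t i)"
        using that u'(1) by (intro member_le_sum[of t "{..<n}"]) (auto intro: sum_nonneg)
      finally show ?thesis using u'(2) by simp
    qed
    have "p u' (Suc m) \<le> (\<Sum>t<n. \<Sum>i<d. u' t i)"
      unfolding p_def
    proof (rule sum_mono)
      fix t assume t: "t \<in> {..<n}"
      then have "(\<Sum>i<d. w i * u' t i) ^ Suc m \<le> (\<Sum>i<d. w i * u' t i) * 1"
        unfolding power_Suc using s s1 by (intro mult_left_mono power_le_one) auto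
      also have "\<dots> \<le> (\<Sum>i<d. u' t i)" using s t by simp
      finally show "(\<Sum>i<d. w i * u' t i) ^ Suc m \<le> (\<Sum>i<d. u' t i)" .
    qed
    moreover have "p u' (Suc m) \<ge> 0"
      unfolding p_def by (rule sum_nonneg, rule zero_le_power) (simp add: s)
    ultimately show "\<bar>p u' (Suc m)\<bar> \<le> 1" using u'(2) by simp
  qed
  \<comment> \<open>Newton's identities do not reach exponent 0, where both power sums equal
    \<open>n\<close>.\<close>
  then show ?thesis using eps by (cases j) (auto simp: p_def)
qed

section \<open>Shifted grids and their separation\<close>

definition digit :: "nat \<Rightarrow> nat \<Rightarrow> nat \<Rightarrow> nat" where
  "digit m t i = (t div m ^ i) mod m"

lemma digit_Suc: "digit m t (Suc i) = digit m (t div m) i"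
  by (simp add: digit_def div_mult2_eq)

text \<open>Base \<open>m\<close> expansion identifies the indices below \<open>m ^ d\<close> with
  the points of a grid of side \<open>m\<close> in dimension \<open>d\<close>.\<close>

lemma digit_eqD:
  assumes "t < m ^ d" and "s < m ^ d" and "\<And>i. i < d \<Longrightarrow> digit m t i = digit m s i"
  shows "t = s"
  using assms
proof (induction d arbitrary: t s)
  case (Suc d)
  have "t div m < m ^ d" "s div m < m ^ d"
    using Suc.prems by (simp_all add: less_mult_imp_div_less mult.commute)
  moreover have "digit m (t div m) i = digit m (s div m) i" if "i < d" for i
    using Suc.prems(3)[of "Suc i"] that by (simp add: digit_Suc)
  ultimately have "t div m = s div m" by (rule Suc.IH)
  moreover have "t mod m = s mod m" using Suc.prems(3)[of 0] by (simp add: digit_def)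
  ultimately show ?case by (metis div_mult_mod_eq)
qed simp

text \<open>The spacing 2 keeps distinct values of a coordinate at least 1 apart after shifts in
  [0,1]. Indices from \<open>m ^ d\<close> on have odds 0, so those variables are constantly
  \<open>e_d\<close> and pad the sum to any larger \<open>n\<close>.\<close>

definition grid_odds :: "nat \<Rightarrow> nat \<Rightarrow> real \<Rightarrow> (nat \<Rightarrow> real) \<Rightarrow> nat \<Rightarrow> nat \<Rightarrow> real" where
  "grid_odds d m T \<delta> t i =
     (if t < m ^ d then (2 * real (digit m t i) + (if i = 0 then \<delta> t else 0)) / T else 0)"

text \<open>A product of affine forms is chosen that vanishes at every grid point of both
  configurations except the point of \<open>t0\<close> in the first. Stability bounds its value
  there from above; the spacing bounds it from below by
  \<open>\<bar>\<delta> t0 - \<delta>' t0\<bar> / T ^ N\<close>.\<close>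

lemma grid_odds_separation:
  assumes d: "d > 0" and m: "m > 0" and n: "m ^ d \<le> n" and T: "4 * real d * real m ^ Suc d \<le> T"
    and \<delta>: "\<And>t. 0 \<le> \<delta> t \<and> \<delta> t \<le> 1" and \<delta>': "\<And>t. 0 \<le> \<delta>' t \<and> \<delta>' t \<le> 1"
    and t0: "t0 < m ^ d"
    and dTV: "dTV (sum_indep_pmf n (\<lambda>t. odds_CRV d (grid_odds d m T \<delta> t))) Q \<le> \<epsilon>"
      "dTV (sum_indep_pmf n (\<lambda>t. odds_CRV d (grid_odds d m T \<delta>' t))) Q \<le> \<epsilon>"
  shows "\<bar>\<delta> t0 - \<delta>' t0\<bar> \<le> (14 * (real (Suc d) * real m) * T) ^ (Suc d * m) * (4 * \<epsilon>)"
proof -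
  define ok where "ok \<gamma> \<longleftrightarrow> (\<forall>t. 0 \<le> \<gamma> t \<and> \<gamma> t \<le> 1)" for \<gamma> :: "nat \<Rightarrow> real"
  have ok: "ok \<delta>" "ok \<delta>'" using \<delta> \<delta>' by (auto simp: ok_def)
  have "4 * 1 * real m \<le> 4 * real d * real m ^ Suc d"
    using d m by (intro mult_mono) (auto simp: self_le_power)
  then have Tm: "T \<ge> 4 * real m" using T by simp
  then have T1: "T \<ge> 1" and T0: "T > 0" using m by linarith+
  have dig: "real (digit m t i) \<le> real m - 1" for t i
  proof -
    have "digit m t i < m" using m by (simp add: digit_def)
    then show ?thesis using m by linarith
  qed
  have odds0: "0 \<le> grid_odds d m T \<gamma> t i" if "ok \<gamma>" for \<gamma> t i
    using that T0 by (auto simp: ok_def grid_odds_def)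
  have odds1: "grid_odds d m T \<gamma> t i \<le> 2 * real m / T" if "ok \<gamma>" for \<gamma> t i
  proof -
    have "2 * real (digit m t i) + (if i = 0 then \<gamma> t else 0) \<le> 2 * real m"
      using dig[of t i] that[unfolded ok_def, rule_format, of t] by auto
    then show ?thesis using T0 by (auto simp: grid_odds_def divide_right_mono)
  qed
  have sum_odds: "(\<Sum>t<n. \<Sum>i<d. grid_odds d m T \<gamma> t i) \<le> 1 / 2" if "ok \<gamma>" for \<gamma>
  proof -
    have "(\<Sum>t<n. \<Sum>i<d. grid_odds d m T \<gamma> t i) = (\<Sum>t<m ^ d. \<Sum>i<d. grid_odds d m T \<gamma> t i)"
      using n by (intro sum.mono_neutral_right) (auto simp: grid_odds_def)
    also have "\<dots> \<le> (\<Sum>t<m ^ d. \<Sum>i<d. 2 * real m / T)"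
      by (intro sum_mono odds1 that)
    also have "\<dots> = (4 * real d * real m ^ Suc d) / (2 * T)" by simp
    also have "\<dots> \<le> 1 / 2" using T T0 by (simp add: pos_divide_le_eq)
    finally show ?thesis .
  qed
  \<comment> \<open>\<open>(i, j, b)\<close> stands for the affine form \<open>v i - c (i, j, b)\<close>. A point differing from \<open>t0\<close> in a
    digit \<open>i > 0\<close> is a zero of some \<open>(i, j, False)\<close>, in both configurations. Of the remaining points,
    \<open>(0, j, False)\<close> kills those of \<open>\<delta>\<close> except \<open>t0\<close>, and \<open>(0, j, True)\<close> those of \<open>\<delta>'\<close> including \<open>t0\<close>.\<close>
  define R where "R = (\<lambda>(i, j). (i, j, False)) ` {(i, j). i < d \<and> j < m \<and> j \<noteq> digit m t0 i}
    \<union> (\<lambda>j. (0, j, True)) ` {..<m}"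
  \<comment> \<open>For \<open>j < m\<close>, \<open>s j\<close> is the index with lowest digit
    \<open>j\<close> and the other digits of \<open>t0\<close>. A form in coordinate 0 must subtract
    the shift belonging to that index.\<close>
  define s where "s j = t0 div m * m + j" for j
  define c where "c = (\<lambda>(i::nat, j, b).
    (2 * real j + (if i = 0 then if b then \<delta>' (s j) else \<delta> (s j) else 0)) / T)"
  define N where "N = card R"
  have sub: "{(i, j). i < d \<and> j < m \<and> j \<noteq> digit m t0 i} \<subseteq> {..<d} \<times> {..<m}" by auto
  have finR: "finite R" unfolding R_def using finite_subset[OF sub] by simp
  have "N \<le> card {(i, j). i < d \<and> j < m \<and> j \<noteq> digit m t0 i} + card {..<m}"
    unfolding N_def R_def
    by (rule order_trans[OF card_Un_le]) (intro add_mono card_image_le finite_subset[OF sub], auto)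
  also have "\<dots> \<le> d * m + m"
    using card_mono[OF _ sub] by (simp add: card_cartesian_product)
  finally have N: "N \<le> Suc d * m" by simp
  have close: "\<bar>(\<Sum>t<n. (\<Sum>i<d. w i * grid_odds d m T \<delta> t i) ^ j) -
      (\<Sum>t<n. (\<Sum>i<d. w i * grid_odds d m T \<delta>' t i) ^ j)\<bar> \<le> 6 ^ j * (4 * \<epsilon>)"
    if "\<And>i. i < d \<Longrightarrow> 0 \<le> w i \<and> w i \<le> 1" for w j
    using that by (intro power_sums_close[where Q = Q] odds0 sum_odds ok dTV)
  have stab: "\<bar>(\<Sum>t<n. \<Prod>r\<in>R. grid_odds d m T \<delta> t (fst r) - c r) -
      (\<Sum>t<n. \<Prod>r\<in>R. grid_odds d m T \<delta>' t (fst r) - c r)\<bar> \<le> (14 * real (card R)) ^ card R * (4 * \<epsilon>)"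
  proof (rule affine_product_stability[OF close finR])
    fix r assume r: "r \<in> R"
    then show "fst r < d" using d by (auto simp: R_def)
    obtain i j b where rij: "r = (i, j, b)" by (cases r) auto
    have "real j \<le> real m - 1" using r rij by (auto simp: R_def)
    then have "\<bar>2 * real j + (if i = 0 then if b then \<delta>' (s j) else \<delta> (s j) else 0)\<bar> \<le> 2 * real m"
      using \<delta>[of "s j"] \<delta>'[of "s j"] by auto
    also have "\<dots> \<le> T" using Tm by simp
    finally show "\<bar>c r\<bar> \<le> 1" using T0 by (simp add: c_def rij)
  qed
  have s0: "s (t0 mod m) = t0" by (simp add: s_def)
  have digit0: "digit m t 0 = t mod m" for t by (simp add: digit_def)
  have zero: "(\<Prod>r\<in>R. grid_odds d m T \<delta> t (fst r) - c r) = 0 \<and>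
      (\<Prod>r\<in>R. grid_odds d m T \<delta>' t (fst r) - c r) = 0" if t: "t < m ^ d" "t \<noteq> t0" for t
  proof (cases "\<exists>i<d. i \<noteq> 0 \<and> digit m t i \<noteq> digit m t0 i")
    case True
    then obtain i where i: "i < d" "i \<noteq> 0" "digit m t i \<noteq> digit m t0 i" by blast
    define r where "r = (i, digit m t i, False)"
    have "r \<in> R" using i m by (auto simp: r_def R_def digit_def)
    moreover have "grid_odds d m T \<gamma> t (fst r) - c r = 0" for \<gamma>
      using i t by (simp add: r_def c_def grid_odds_def)
    ultimately show ?thesis using finR by (auto simp: prod_zero_iff)
  next
    case False
    then have same: "digit m t i = digit m t0 i" if "i < d" "i \<noteq> 0" for i using that by blast
    have "t mod m \<noteq> t0 mod m"
    proof
      assume "t mod m = t0 mod m"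
      then have "digit m t i = digit m t0 i" if "i < d" for i
        using same that by (cases "i = 0") (auto simp: digit0)
      then show False using digit_eqD[OF t(1) t0] t(2) by blast
    qed
    moreover have "t div m = t0 div m"
    proof (rule digit_eqD)
      obtain d' where d': "d = Suc d'" using d by (cases d) auto
      show "t div m < m ^ (d - 1)" "t0 div m < m ^ (d - 1)"
        using t t0 by (simp_all add: d' less_mult_imp_div_less mult.commute)
      show "digit m (t div m) i = digit m (t0 div m) i" if "i < d - 1" for i
        using same[of "Suc i"] that by (simp add: digit_Suc)
    qed
    then have st: "s (t mod m) = t" by (simp add: s_def flip: \<open>t div m = t0 div m\<close>)
    ultimately have "(0, t mod m, False) \<in> R" "(0, t mod m, True) \<in> R"
      using d m by (auto simp: R_def digit0)
    moreover have "grid_odds d m T \<delta> t 0 - c (0, t mod m, False) = 0"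
      "grid_odds d m T \<delta>' t 0 - c (0, t mod m, True) = 0"
      using t st by (simp_all add: c_def grid_odds_def digit0)
    ultimately show ?thesis using finR by (force simp: prod_zero_iff)
  qed
  have zero': "(\<Prod>r\<in>R. grid_odds d m T \<delta>' t0 (fst r) - c r) = 0"
  proof -
    have "(0, t0 mod m, True) \<in> R" using m by (auto simp: R_def)
    moreover have "grid_odds d m T \<delta>' t0 0 - c (0, t0 mod m, True) = 0"
      using t0 s0 by (simp add: c_def grid_odds_def digit0)
    ultimately show ?thesis using finR by (force simp: prod_zero_iff)
  qed
  define F where "F \<gamma> t = (\<Prod>r\<in>R. grid_odds d m T \<gamma> t (fst r) - c r)" for \<gamma> t
  have "(\<Sum>t<n. F \<delta> t) - (\<Sum>t<n. F \<delta>' t) = (\<Sum>t<n. F \<delta> t - F \<delta>' t)"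
    by (simp add: sum_subtractf)
  also have "\<dots> = (\<Sum>t\<in>{t0}. F \<delta> t - F \<delta>' t)"
  proof (rule sum.mono_neutral_right)
    \<comment> \<open>Padding indices have the same odds, 0, in both configurations, so their terms
      cancel although the products there need not vanish.\<close>
    show "\<forall>t\<in>{..<n} - {t0}. F \<delta> t - F \<delta>' t = 0"
    proof
      fix t assume "t \<in> {..<n} - {t0}"
      then show "F \<delta> t - F \<delta>' t = 0"
        using zero[of t] by (cases "t < m ^ d") (auto simp: F_def grid_odds_def)
    qed
  qed (use t0 n in auto)
  finally have "(\<Sum>t<n. F \<delta> t) - (\<Sum>t<n. F \<delta>' t) = F \<delta> t0" using zero' by (simp add: F_def)
  then have upper: "\<bar>F \<delta> t0\<bar> \<le> (14 * real N) ^ N * (4 * \<epsilon>)"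
    using stab by (simp add: F_def N_def)
  \<comment> \<open>\<open>r0\<close> vanishes at the point of \<open>t0\<close> in the second
    configuration. At that in the first it is the one factor that can be small, and it carries the
    difference of the shifts.\<close>
  define r0 where "r0 = (0::nat, t0 mod m, True)"
  have r0: "r0 \<in> R" using m by (auto simp: r0_def R_def)
  have factor0: "\<bar>grid_odds d m T \<delta> t0 (fst r0) - c r0\<bar> = \<bar>\<delta> t0 - \<delta>' t0\<bar> / T"
    using t0 s0 T0 by (simp add: r0_def c_def grid_odds_def digit0 flip: diff_divide_distrib)
  \<comment> \<open>The grid values \<open>2 * j\<close> differ by at least 2 here, and the shifts
    by at most 1.\<close>
  have factor: "1 / T \<le> \<bar>grid_odds d m T \<delta> t0 (fst r) - c r\<bar>" if r: "r \<in> R - {r0}" for r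
  proof -
    obtain i j b where rij: "r = (i, j, b)" by (cases r) auto
    have "j \<noteq> digit m t0 i" using r by (auto simp: rij R_def r0_def digit0)
    then have "1 \<le> \<bar>real (digit m t0 i) - real j\<bar>" by linarith
    moreover define \<gamma> where "\<gamma> = (if i = 0 then if b then \<delta>' (s j) else \<delta> (s j) else 0)"
    moreover have "\<bar>(if i = 0 then \<delta> t0 else 0) - \<gamma>\<bar> \<le> 1"
      using \<delta>[of t0] \<delta>[of "s j"] \<delta>'[of "s j"] by (auto simp: \<gamma>_def abs_le_iff)
    ultimately have "1 \<le> \<bar>2 * real (digit m t0 i) + (if i = 0 then \<delta> t0 else 0) - (2 * real j + \<gamma>)\<bar>"
      by linarith
    moreover have "grid_odds d m T \<delta> t0 (fst r) - c r =
        (2 * real (digit m t0 i) + (if i = 0 then \<delta> t0 else 0) - (2 * real j + \<gamma>)) / T"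
      using t0 by (simp add: rij c_def grid_odds_def \<gamma>_def diff_divide_distrib)
    ultimately show ?thesis using T0 by (simp add: divide_right_mono)
  qed
  have N1: "N > 0" unfolding N_def using r0 finR by (auto simp: card_gt_0_iff)
  have "\<bar>\<delta> t0 - \<delta>' t0\<bar> / T * (1 / T) ^ (N - 1) \<le>
      \<bar>grid_odds d m T \<delta> t0 (fst r0) - c r0\<bar> * (\<Prod>r\<in>R - {r0}. \<bar>grid_odds d m T \<delta> t0 (fst r) - c r\<bar>)"
  proof -
    have "(1 / T) ^ (N - 1) = (\<Prod>r\<in>R - {r0}. 1 / T)" using r0 finR by (simp add: N_def)
    also have "\<dots> \<le> (\<Prod>r\<in>R - {r0}. \<bar>grid_odds d m T \<delta> t0 (fst r) - c r\<bar>)"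
      using factor T0 by (intro prod_mono) auto
    finally show ?thesis unfolding factor0 using T0 by (intro mult_left_mono) auto
  qed
  also have "\<dots> = \<bar>F \<delta> t0\<bar>"
    unfolding F_def abs_prod by (rule prod.remove[OF finR r0, symmetric])
  also note upper
  finally have "\<bar>\<delta> t0 - \<delta>' t0\<bar> / T ^ N \<le> (14 * real N) ^ N * (4 * \<epsilon>)"
    using N1 by (cases N) (auto simp: power_divide)
  then have "\<bar>\<delta> t0 - \<delta>' t0\<bar> \<le> (14 * real N * T) ^ N * (4 * \<epsilon>)"
    using T0 by (simp add: pos_divide_le_eq power_mult_distrib mult_ac)
  also have "\<dots> \<le> (14 * (real (Suc d) * real m) * T) ^ (Suc d * m) * (4 * \<epsilon>)"
  proof (rule mult_right_mono)
    have NN: "real N \<le> real (Suc d) * real m" using N by (metis of_nat_le_iff of_nat_mult)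
    have "(14 * real N * T) ^ N \<le> (14 * (real (Suc d) * real m) * T) ^ N"
      using NN T0 by (intro power_mono mult_right_mono mult_left_mono) auto
    \<comment> \<open>The number of forms is only bounded above, so raising the exponent needs a
      base of at least 1.\<close>
    also have "\<dots> \<le> (14 * (real (Suc d) * real m) * T) ^ (Suc d * m)"
    proof (rule power_increasing[OF N])
      have "1 \<le> real N" using N1 by simp
      then have "1 * 1 \<le> (14 * (real (Suc d) * real m)) * T" using NN T1 by (intro mult_mono) auto
      then show "1 \<le> 14 * (real (Suc d) * real m) * T" by simp
    qed
    finally show "(14 * real N * T) ^ N \<le> (14 * (real (Suc d) * real m) * T) ^ (Suc d * m)" .
    show "4 * \<epsilon> \<ge> 0" using close[of "\<lambda>_. 0" 0] by simp
  qed
  finally show ?thesis .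
qed

section \<open>Two counting bounds for covers\<close>

lemma card_le_card_cover:
  assumes cover: "is_PMD_cover \<epsilon> n k C" and C: "finite C"
    and PMD: "\<And>b. b \<in> J \<Longrightarrow> f b \<in> PMDs n k"
    and sep: "\<And>b b' Q. b \<in> J \<Longrightarrow> b' \<in> J \<Longrightarrow> dTV (f b) Q \<le> \<epsilon> \<Longrightarrow> dTV (f b') Q \<le> \<epsilon> \<Longrightarrow> b = b'"
  shows "card J \<le> card C"
proof -
  have "\<exists>Q\<in>C. dTV (f b) Q \<le> \<epsilon>" if "b \<in> J" for b
    using cover PMD[OF that] by (auto simp: is_PMD_cover_def)
  then obtain g where g: "\<And>b. b \<in> J \<Longrightarrow> g b \<in> C \<and> dTV (f b) (g b) \<le> \<epsilon>" by metis
  have "inj_on g J"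
  proof (rule inj_onI)
    fix b b' assume "b \<in> J" "b' \<in> J" "g b = g b'"
    then show "b = b'" using g[of b] g[of b'] sep[of b b' "g b"] by simp
  qed
  then show ?thesis using g C by (intro card_inj_on_le[of g]) auto
qed

text \<open>Constant summands give point masses whose first \<open>d\<close> coordinates range
  freely over \<open>0, ..., n div d\<close>. An indicator separates two of them once
  \<open>4 * \<epsilon> < 1\<close>.\<close>

lemma point_mass_bound:
  assumes cover: "is_PMD_cover \<epsilon> n (Suc d) C" and C: "finite C" and \<epsilon>: "\<epsilon> < 1 / 4"
  shows "(n div d + 1) ^ d \<le> card C"
proof -
  define q where "q = n div d"
  define J where "J = PiE {..<d} (\<lambda>_. {..q})"
  \<comment> \<open>The indices are cut into \<open>d\<close> blocks of length \<open>q\<close>. In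
    block \<open>i\<close> the first \<open>b i\<close> variables are \<open>e_i\<close>; all others
    are \<open>e_d\<close>.\<close>
  define c where "c b t = (if t div q < d \<and> t mod q < b (t div q) then t div q else d)"
    for b :: "nat \<Rightarrow> nat" and t
  define x where "x b = (\<lambda>i. \<Sum>t<n. std_basis (c b t) i)" for b
  define f where "f b = sum_indep_pmf n (\<lambda>t. return_pmf (std_basis (c b t)))" for b
  have f: "f b = return_pmf (x b)" for b
    unfolding f_def sum_indep_pmf_def x_def by (simp add: Pi_pmf_return_pmf)
  have x: "x b i = real (b i)" if b: "b \<in> J" and i: "i < d" for b i
  proof -
    have bi: "b i \<le> q" using b i by (auto simp: J_def)
    have "q * d \<le> n" by (simp add: q_def)
    have "{t. t < n \<and> c b t = i} = (\<lambda>s. i * q + s) ` {..<b i}"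
    proof (intro equalityI subsetI)
      fix t assume "t \<in> {t. t < n \<and> c b t = i}"
      then have "t div q = i" "t mod q < b i" using i by (auto simp: c_def split: if_splits)
      then show "t \<in> (\<lambda>s. i * q + s) ` {..<b i}"
        by (intro image_eqI[of _ _ "t mod q"]) auto
    next
      fix t assume "t \<in> (\<lambda>s. i * q + s) ` {..<b i}"
      then obtain s where s: "t = i * q + s" "s < b i" by auto
      have "t < (i + 1) * q" using s bi by simp
      also have "\<dots> \<le> d * q" using i by (intro mult_right_mono) auto
      also have "\<dots> \<le> n" using \<open>q * d \<le> n\<close> by (simp add: mult.commute)
      finally have "t < n" .
      moreover have "t div q = i" "t mod q = s" using s bi by auto
      ultimately show "t \<in> {t. t < n \<and> c b t = i}" using s i by (simp add: c_def)
    qed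
    moreover have "card ((\<lambda>s. i * q + s) ` {..<b i}) = b i"
      by (subst card_image) auto
    ultimately have "card {t. t < n \<and> c b t = i} = b i" by simp
    moreover have "x b i = (\<Sum>t<n. of_bool (c b t = i))"
      unfolding x_def std_basis_def by (intro sum.cong) auto
    moreover have "(\<Sum>t<n. of_bool (c b t = i)) = real (card ({..<n} \<inter> {t. c b t = i}))"
      by (subst sum_of_bool_eq) auto
    moreover have "{..<n} \<inter> {t. c b t = i} = {t. t < n \<and> c b t = i}" by auto
    ultimately show ?thesis by simp
  qed
  have "card J \<le> card C"
  proof (rule card_le_card_cover[OF cover C])
    show "f b \<in> PMDs n (Suc d)" for b
      unfolding f_def PMDs_def is_CRV_def
      by (intro CollectI exI conjI refl) (auto simp: c_def)
    fix b b' Q assume b: "b \<in> J" "b' \<in> J" and Q: "dTV (f b) Q \<le> \<epsilon>" "dTV (f b') Q \<le> \<epsilon>"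
    have "\<bar>measure_pmf.expectation (f b) (indicator {x b}) -
        measure_pmf.expectation (f b') (indicator {x b})\<bar> \<le> 4 * \<epsilon>"
      using Q by (intro expectation_diff_le_dTV) (auto simp: f indicator_def)
    then have "x b = x b'"
      using \<epsilon> by (cases "x b' = x b") (auto simp: f indicator_def)
    then have "b i = b' i" if "i < d" for i
      using x b that by (metis of_nat_eq_iff)
    then show "b = b'" using b unfolding J_def by (intro PiE_ext) auto
  qed
  then show ?thesis by (simp add: J_def card_PiE q_def)
qed

lemma grid_odds_nonneg:
  assumes "T \<ge> 0" and "\<And>t. 0 \<le> \<delta> t"
  shows "0 \<le> grid_odds d m T \<delta> t i"
  using assms by (auto simp: grid_odds_def)

text \<open>Each of the \<open>m ^ d\<close> shifts is chosen independently among \<open>G\<close>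
  multiples of \<eta>. Separation forces shifts served by a common cover member to differ by less
  than \<eta>, hence to agree.\<close>

lemma grid_bound:
  assumes cover: "is_PMD_cover \<epsilon> n (Suc d) C" and C: "finite C"
    and d: "d > 0" and m: "m > 0" and n: "m ^ d \<le> n" and T: "T = 4 * real d * real m ^ Suc d"
    and \<eta>: "(14 * (real (Suc d) * real m) * T) ^ (Suc d * m) * (4 * \<epsilon>) < \<eta>" "0 < \<eta>"
    and G: "real G * \<eta> \<le> 1"
  shows "G ^ (m ^ d) \<le> card C"
proof -
  define J where "J = PiE {..<m ^ d} (\<lambda>_. {..<G})"
  \<comment> \<open>The default 0 replaces the unspecified values of \<open>b\<close> outside its
    domain, since the bounds on shifts are required at every index.\<close>
  define \<delta> where "\<delta> b t = (if t < m ^ d then \<eta> * real (b t) else 0)" for b :: "nat \<Rightarrow> nat" and t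
  define f where "f b = sum_indep_pmf n (\<lambda>t. odds_CRV d (grid_odds d m T (\<delta> b) t))" for b
  have \<delta>: "0 \<le> \<delta> b t \<and> \<delta> b t \<le> 1" if "b \<in> J" for b t
  proof (cases "t < m ^ d")
    case True
    then have "real (b t) \<le> real G" using that by (auto simp: J_def PiE_iff intro: less_imp_le)
    then have "\<eta> * real (b t) \<le> \<eta> * real G" using \<eta>(2) by (intro mult_left_mono) auto
    also have "\<dots> \<le> 1" using G by (simp add: mult.commute)
    finally show ?thesis using True \<eta>(2) by (simp add: \<delta>_def)
  qed (simp add: \<delta>_def)
  have "card J \<le> card C"
  proof (rule card_le_card_cover[OF cover C])
    fix b assume b: "b \<in> J"
    show "f b \<in> PMDs n (Suc d)"
      unfolding f_def using \<delta>[OF b] by (intro odds_PMD_in_PMDs grid_odds_nonneg) (auto simp: T)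
    fix b' Q assume b': "b' \<in> J" and Q: "dTV (f b) Q \<le> \<epsilon>" "dTV (f b') Q \<le> \<epsilon>"
    have "b t = b' t" if t: "t < m ^ d" for t
    proof (rule ccontr)
      assume "b t \<noteq> b' t"
      then have "\<eta> * 1 \<le> \<eta> * \<bar>real (b t) - real (b' t)\<bar>"
        using \<eta> by (intro mult_left_mono) linarith+
      also have "\<dots> = \<bar>\<delta> b t - \<delta> b' t\<bar>"
        using t \<eta> by (simp add: \<delta>_def abs_mult flip: right_diff_distrib)
      also have "\<dots> \<le> (14 * (real (Suc d) * real m) * T) ^ (Suc d * m) * (4 * \<epsilon>)"
        by (rule grid_odds_separation[OF d m n _ \<delta>[OF b] \<delta>[OF b'] t Q[unfolded f_def]])
          (simp add: T)
      finally show False using \<eta> by simp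
    qed
    then show "b = b'" using b b' unfolding J_def by (intro PiE_ext) auto
  qed
  then show ?thesis by (simp add: J_def card_PiE)
qed

section \<open>Choice of parameters and asymptotics\<close>

lemma eventually_div_ln_ge: "eventually (\<lambda>x::real. M \<le> x / ln x) at_top"
proof -
  define K where "K = max M 1"
  have "eventually (\<lambda>x. ln x / x < 1 / K) at_top"
    using order_tendstoD(2)[OF ln_x_over_x_tendsto_0, of "1 / K"] by (simp add: K_def)
  moreover have "eventually (\<lambda>x::real. x > exp 1) at_top" by (rule eventually_gt_at_top)
  ultimately show ?thesis
  proof eventually_elim
    case (elim x)
    have x: "x > 0" using elim(2) less_trans[OF exp_gt_zero] by blast
    then have ln: "ln x > 0" using elim(2) by (metis exp_gt_one less_trans ln_gt_zero zero_less_one)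
    have K: "K > 0" by (simp add: K_def)
    have "K * ln x \<le> x" using elim(1) x K by (simp add: field_simps)
    then have "K \<le> x / ln x" using ln by (simp add: pos_le_divide_eq)
    then show ?case by (simp add: K_def)
  qed
qed

text \<open>The constant \<open>c\<close> is such that the separation factor is at most
  \<open>exp (x / 4)\<close>, that is \<epsilon> to the power -1/4. The two counts are multiplied,
  and the square root halves the exponents 1/4 to 1/8.\<close>

lemma cover_bound:
  fixes \<epsilon> :: real and d n :: nat
  defines "k \<equiv> real (Suc d)"
  defines "x \<equiv> ln (1 / \<epsilon>)"
  defines "L \<equiv> x / ln x"
  defines "c \<equiv> 1 / (4 * k * (k + 2))"
  assumes d: "d \<ge> 2" and \<epsilon>: "\<epsilon> > 0" and x: "x \<ge> 16" and L: "c * L \<ge> 56 * k\<^sup>2 + 1" "L \<ge> k\<^sup>2"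
    and n: "real n \<ge> L ^ d" and cover: "is_PMD_cover \<epsilon> n (Suc d) C" and C: "finite C"
  shows "real (card C) \<ge> real n powr (1 / 8 * k) * (1 / \<epsilon>) powr ((c / 2) ^ d / 8 * L ^ d)"
proof -
  have k: "k \<ge> 3" using d by (simp add: k_def)
  have eps: "\<epsilon> = exp (- x)" using \<epsilon> by (simp add: x_def ln_div)
  have "exp 1 \<le> x" using exp_le x by linarith
  then have lnx: "ln x \<ge> 1" using x by (simp add: ln_ge_iff)
  have "1 \<le> k\<^sup>2" using k by (simp add: one_le_power)
  then have L1: "L \<ge> 1" using L by linarith
  have Lx: "L \<le> x" unfolding L_def using lnx x by (simp add: divide_le_eq)
  have "4 * k * (k + 2) \<ge> 4 * 3 * (3 + 2)" using k by (intro mult_mono) auto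
  then have c0: "c > 0" and c1: "c \<le> 1" by (auto simp: c_def)
  define m where "m = nat \<lfloor>c * L\<rfloor>"
  have m_le: "real m \<le> c * L" using c0 L1 by (simp add: m_def)
  have m_ge: "real m \<ge> c * L - 1" by (simp add: m_def) linarith
  have m56: "real m \<ge> 56 * k\<^sup>2" using m_ge L by linarith
  have m1: "real m \<ge> 1" using m56 \<open>1 \<le> k\<^sup>2\<close> by linarith
  have m_half: "real m \<ge> c / 2 * L" using m_ge L \<open>1 \<le> k\<^sup>2\<close> by linarith
  have mL: "real m \<le> L" using m_le c1 L1 mult_right_mono[of c 1 L] by linarith
  have "ln (real m) \<le> ln x" using m1 mL Lx by simp
  have y4: "4 < exp (x / 4)" using exp_ge_add_one_self[of "x / 4"] x by linarith
  define T where "T = 4 * real d * real m ^ Suc d"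
  \<comment> \<open>The left side is \<open>56 * k * d\<close> times \<open>m\<close> to the power
    \<open>k + 1\<close>; one more factor \<open>m\<close>, at least \<open>56 * k\<^sup>2\<close>,
    absorbs the constant.\<close>
  have base: "14 * (real (Suc d) * real m) * T \<le> real m ^ (Suc d + 2)"
  proof -
    have "14 * (real (Suc d) * real m) * T = 56 * (k * real d) * (real m * real m ^ Suc d)"
      by (simp add: T_def k_def)
    also have "\<dots> \<le> 56 * (k * k) * (real m * real m ^ Suc d)"
      using k by (intro mult_right_mono mult_left_mono) (auto simp: k_def)
    also have "\<dots> \<le> real m * (real m * real m ^ Suc d)"
      using m56 by (intro mult_right_mono) (auto simp: power2_eq_square)
    finally show ?thesis by simp
  qed
  have "(14 * (real (Suc d) * real m) * T) ^ (Suc d * m) \<le> (real m ^ (Suc d + 2)) ^ (Suc d * m)"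
    using base by (intro power_mono) (simp_all add: T_def)
  also have "\<dots> = exp ((k + 2) * k * real m * ln (real m))"
  proof -
    have "real m = exp (ln (real m))" using m1 by simp
    then have "(real m ^ (Suc d + 2)) ^ (Suc d * m) = exp (real ((Suc d + 2) * (Suc d * m)) * ln (real m))"
      by (metis exp_of_nat_mult power_mult)
    moreover have "real ((Suc d + 2) * (Suc d * m)) = (k + 2) * k * real m"
      by (simp only: k_def of_nat_mult of_nat_add of_nat_numeral mult.assoc)
    ultimately show ?thesis by simp
  qed
  also have "\<dots> \<le> exp ((k + 2) * k * (c * L) * ln x)"
    using k m_le m1 \<open>ln (real m) \<le> ln x\<close> c0 L1 by (subst exp_le_cancel_iff) (intro mult_mono, auto)
  also have "(k + 2) * k * (c * L) * ln x = x / 4"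
  proof -
    have kc: "k * (k + 2) * c = 1 / 4" using k by (simp add: c_def)
    have Lln: "L * ln x = x" using lnx by (simp add: L_def)
    have "(k + 2) * k * (c * L) * ln x = (k * (k + 2) * c) * (L * ln x)" by simp
    then show ?thesis unfolding kc Lln by simp
  qed
  finally have big: "(14 * (real (Suc d) * real m) * T) ^ (Suc d * m) \<le> exp (x / 4)" .
  \<comment> \<open>The step \<eta> is the square root of \<epsilon>. It exceeds the separation
    bound \<open>4 * exp (x / 4) * \<epsilon>\<close> because \<open>4 < exp (x / 4)\<close>, which
    is where \<open>x \<ge> 16\<close> enters.\<close>
  define \<eta> where "\<eta> = exp (- (x / 2))"
  define G where "G = nat \<lfloor>exp (x / 2)\<rfloor>"
  have exp_half: "exp (x / 2) = exp (x / 4) * exp (x / 4)" by (simp flip: exp_add)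
  have "(14 * (real (Suc d) * real m) * T) ^ (Suc d * m) * (4 * \<epsilon>) \<le> exp (x / 4) * (4 * \<epsilon>)"
    using big \<epsilon> by (intro mult_right_mono) auto
  also have "\<dots> < exp (x / 4) * (exp (x / 4) * \<epsilon>)"
    using y4 \<epsilon> by simp
  also have "\<dots> = \<eta>" unfolding \<eta>_def eps by (simp flip: exp_add)
  finally have \<eta>: "(14 * (real (Suc d) * real m) * T) ^ (Suc d * m) * (4 * \<epsilon>) < \<eta>" .
  have "real G \<le> exp (x / 2)" by (simp add: G_def)
  then have G: "real G * \<eta> \<le> 1"
    using mult_right_mono[of "real G" "exp (x / 2)" \<eta>] by (simp add: \<eta>_def flip: exp_add)
  have "real G \<ge> exp (x / 2) - 1" by (simp add: G_def)
  moreover have "exp (x / 4) * 4 \<le> exp (x / 2)"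
    unfolding exp_half using y4 by (intro mult_left_mono) auto
  ultimately have G_ge: "real G \<ge> exp (x / 4)" using y4 by linarith
  have "real (m ^ d) \<le> L ^ d" using mL by (simp add: power_mono)
  then have mn: "m ^ d \<le> n" using n by linarith
  have hard: "exp (x * ((c / 2) ^ d / 4 * L ^ d)) \<le> real (card C)"
  proof -
    have "(c / 2) ^ d * L ^ d \<le> real m ^ d"
      unfolding power_mult_distrib[symmetric] using m_half c0 L1 by (intro power_mono) auto
    then have "x / 4 * ((c / 2) ^ d * L ^ d) \<le> x / 4 * real m ^ d"
      using x by (intro mult_left_mono) auto
    moreover have "x * ((c / 2) ^ d / 4 * L ^ d) = x / 4 * ((c / 2) ^ d * L ^ d)" by simp
    ultimately have "x * ((c / 2) ^ d / 4 * L ^ d) \<le> real (m ^ d) * (x / 4)"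
      by (simp only: of_nat_power mult.commute)
    then have "exp (x * ((c / 2) ^ d / 4 * L ^ d)) \<le> exp (real (m ^ d) * (x / 4))" by simp
    also have "\<dots> = exp (x / 4) ^ (m ^ d)" by (rule exp_of_nat_mult)
    also have "\<dots> \<le> real G ^ (m ^ d)" using G_ge by (intro power_mono) auto
    also have "\<dots> \<le> real (card C)"
    proof -
      have "G ^ (m ^ d) \<le> card C"
        using d m1 by (intro grid_bound[OF cover C _ _ mn T_def \<eta> _ G]) (auto simp: \<eta>_def)
      then show ?thesis by (metis of_nat_le_iff of_nat_power)
    qed
    finally show ?thesis .
  qed
  have "L ^ 1 \<le> L ^ d" using d L1 by (intro power_increasing) auto
  then have nk: "real n \<ge> k\<^sup>2" using n L by simp
  then have n1: "real n \<ge> 1" using \<open>1 \<le> k\<^sup>2\<close> by linarith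
  \<comment> \<open>From \<open>n \<ge> k\<^sup>2\<close> the quotient \<open>n / d\<close> is at
    least \<open>sqrt n\<close>, so the point masses give \<open>n\<close> to the power
    \<open>d / 2\<close>, and \<open>d / 2 \<ge> k / 4\<close>.\<close>
  have simple: "real n powr (k / 4) \<le> real (card C)"
  proof -
    have "real d \<le> sqrt (real n)"
      using nk k by (intro real_le_rsqrt order_trans[OF _ nk] power_mono) (auto simp: k_def)
    then have "sqrt (real n) * real d \<le> sqrt (real n) * sqrt (real n)" by (intro mult_left_mono) auto
    then have "sqrt (real n) \<le> real n / real d" using d by (simp add: pos_le_divide_eq)
    also have "\<dots> \<le> real (n div d + 1)"
    proof -
      have "n < (n div d + 1) * d" using d by (simp add: dividend_less_div_times)
      then have "real n \<le> real ((n div d + 1) * d)" by (intro of_nat_mono) simp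
      then show ?thesis using d by (simp add: pos_divide_le_eq distrib_right)
    qed
    finally have sq: "sqrt (real n) \<le> real (n div d + 1)" .
    have "real n powr (k / 4) \<le> real n powr (1 / 2 * real d)"
      using n1 d by (intro powr_mono) (auto simp: k_def)
    also have "\<dots> = (real n powr (1 / 2)) powr real d" by (rule powr_powr[symmetric])
    also have "\<dots> = sqrt (real n) ^ d"
      using n1 by (simp add: powr_half_sqrt powr_realpow)
    also have "\<dots> \<le> real (n div d + 1) ^ d" using sq by (intro power_mono) auto
    also have "\<dots> = real ((n div d + 1) ^ d)" by simp
    also have "\<dots> \<le> real (card C)"
    proof -
      have "exp (x / 4) \<le> exp x" using x by simp
      then have "4 < exp x" using y4 by linarith
      then have "\<epsilon> < 1 / 4" unfolding eps by (simp add: exp_minus field_simps)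
      then show ?thesis using point_mass_bound[OF cover C] by (intro of_nat_mono) auto
    qed
    finally show ?thesis .
  qed
  have "real n powr (k / 4) * exp (x * ((c / 2) ^ d / 4 * L ^ d)) \<le> real (card C) * real (card C)"
    using simple hard by (intro mult_mono) auto
  moreover have "real n powr (k / 4) * exp (x * ((c / 2) ^ d / 4 * L ^ d)) =
      (real n powr (1 / 8 * k) * (1 / \<epsilon>) powr ((c / 2) ^ d / 8 * L ^ d))\<^sup>2"
  proof -
    have "(1 / \<epsilon>) powr ((c / 2) ^ d / 8 * L ^ d) = exp (x * ((c / 2) ^ d / 8 * L ^ d))"
      using \<epsilon> by (simp add: powr_def x_def mult.commute)
    moreover have "(exp (x * ((c / 2) ^ d / 8 * L ^ d)))\<^sup>2 = exp (x * ((c / 2) ^ d / 4 * L ^ d))"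
      by (simp add: power2_eq_square flip: exp_add)
    moreover have "(real n powr (1 / 8 * k))\<^sup>2 = real n powr (k / 4)"
      by (simp add: power2_eq_square flip: powr_add)
    ultimately show ?thesis by (simp only: power_mult_distrib)
  qed
  ultimately have "(real n powr (1 / 8 * k) * (1 / \<epsilon>) powr ((c / 2) ^ d / 8 * L ^ d))\<^sup>2 \<le> (real (card C))\<^sup>2"
    by (simp only: power2_eq_square)
  then show ?thesis by (rule power2_le_imp_le) simp
qed

theorem theorem1p5:
  shows "\<exists>c::real. c > 0 \<and>
    (\<forall>k::nat. k > 2 \<longrightarrow>
      (\<exists>A B \<epsilon>\<^sub>0 :: real. A > 0 \<and> B > 0 \<and> \<epsilon>\<^sub>0 > 0 \<and>
        (\<forall>(\<epsilon>::real) (n::nat) C.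
           0 < \<epsilon> \<longrightarrow> \<epsilon> < \<epsilon>\<^sub>0 \<longrightarrow>
           real n \<ge> A * (ln (1 / \<epsilon>) / ln (ln (1 / \<epsilon>))) ^ (k - 1) \<longrightarrow>
           is_PMD_cover \<epsilon> n k C \<longrightarrow> finite C \<longrightarrow>
           real (card C) \<ge>
             real n powr (c * real k) *
             (1 / \<epsilon>) powr (B * (ln (1 / \<epsilon>) / ln (ln (1 / \<epsilon>))) ^ (k - 1)))))"
proof (rule exI[of _ "1 / 8"], intro conjI allI impI)
  fix k :: nat assume k: "k > 2"
  obtain d where d: "k = Suc d" "d \<ge> 2" using k by (cases k) auto
  define c where "c = 1 / (4 * real k * (real k + 2))"
  have c: "c > 0" using k by (simp add: c_def)
  \<comment> \<open>\<open>M\<close> combines the two lower bounds that \<open>cover_bound\<close>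
    requires of \<open>L\<close>.\<close>
  define M where "M = max ((56 * (real k)\<^sup>2 + 1) / c) ((real k)\<^sup>2)"
  obtain x0 where x0: "\<And>x. x \<ge> x0 \<Longrightarrow> M \<le> x / ln x"
    using eventually_div_ln_ge[of M] unfolding eventually_at_top_linorder by blast
  define X where "X = max x0 16"
  show "\<exists>A B \<epsilon>\<^sub>0 :: real. A > 0 \<and> B > 0 \<and> \<epsilon>\<^sub>0 > 0 \<and>
        (\<forall>(\<epsilon>::real) (n::nat) C.
           0 < \<epsilon> \<longrightarrow> \<epsilon> < \<epsilon>\<^sub>0 \<longrightarrow>
           real n \<ge> A * (ln (1 / \<epsilon>) / ln (ln (1 / \<epsilon>))) ^ (k - 1) \<longrightarrow>
           is_PMD_cover \<epsilon> n k C \<longrightarrow> finite C \<longrightarrow>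
           real (card C) \<ge>
             real n powr (1 / 8 * real k) *
             (1 / \<epsilon>) powr (B * (ln (1 / \<epsilon>) / ln (ln (1 / \<epsilon>))) ^ (k - 1)))"
  \<comment> \<open>Below \<open>exp (- X)\<close>, \<open>ln (1 / \<epsilon>)\<close> exceeds both
    \<open>x0\<close>, which yields the bound \<open>M\<close>, and 16.\<close>
  proof (rule exI[of _ 1], rule exI[of _ "(c / 2) ^ d / 8"], rule exI[of _ "exp (- X)"],
      intro conjI allI impI)
    fix \<epsilon> :: real and n C
    assume \<epsilon>: "0 < \<epsilon>" "\<epsilon> < exp (- X)"
      and n: "real n \<ge> 1 * (ln (1 / \<epsilon>) / ln (ln (1 / \<epsilon>))) ^ (k - 1)"
      and C: "is_PMD_cover \<epsilon> n k C" "finite C"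
    have "ln \<epsilon> < - X" using \<epsilon> by (metis exp_gt_zero ln_exp ln_less_cancel_iff)
    then have X: "X \<le> ln (1 / \<epsilon>)" using \<epsilon> by (simp add: ln_div)
    then have M: "M \<le> ln (1 / \<epsilon>) / ln (ln (1 / \<epsilon>))" by (intro x0) (simp add: X_def)
    then have "56 * (real k)\<^sup>2 + 1 \<le> c * (ln (1 / \<epsilon>) / ln (ln (1 / \<epsilon>)))"
      using c by (simp add: M_def pos_divide_le_eq mult.commute)
    then show "real (card C) \<ge> real n powr (1 / 8 * real k) *
        (1 / \<epsilon>) powr ((c / 2) ^ d / 8 * (ln (1 / \<epsilon>) / ln (ln (1 / \<epsilon>))) ^ (k - 1))"
      using cover_bound[of d \<epsilon> n C] d \<epsilon> X M n C by (simp add: c_def X_def M_def)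
  qed (use c in auto)
qed simp

end
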